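(* Let $N\ge K\ge 1$ and $M\ge 2$ be integers, and let $p>0$, $\alpha>0$, and $d_k>0$, $\sigma_k^2>0$ for $k=1,\dots,K$. Let $\beta>0$ be the constant scaling factor defined in the context, and for each $k\in\{1,\dots,K\}$ let $R_k^{ZF,\mathrm{av}}$ be the average rate of user $k$ under zero-forcing precoding with $M$-PSK inputs, as defined in the context. Let an index $j\in\{1,\dots,M^N\}$ be chosen (the choice may depend on $m$; for instance $j=m$ is allowed). Then the total sum rate has the upper bound $$\sum_{k=1}^K R_k^{ZF,\mathrm{av}}\;\le\; R^{ZF}=\sum_{k=1}^K \bar R_k^{ZF},$$ where $$\bar R_k^{ZF}=N\log_2 M-\log_2 e-\frac{1}{M^N}\sum_{m=1}^{M^N}\left\{-\Big(\big|\beta[\mathbf{s}_{m,j}]_k\big|^2+\sigma_k^2\Big)\frac{\log_2 e}{\sigma_k^2}+\log_2\Big(1+\sum_{\substack{i=1\\ i\neq j}}^{M^N}e^{-\frac{|\beta[\mathbf{s}_{m,i}]_k|^2-|\beta[\mathbf{s}_{m,j}]_k|^2}{2\sigma_k^2}}\Big)\right\}.$$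
   Context: A base station with $N$ antennas serves $K\le N$ single-antenna users over a Rayleigh fading channel $\mathbf{H}=\mathbf{D}^{1/2}\mathbf{H}_1\in\mathbb{C}^{K\times N}$, where $\mathbf{H}_1$ has i.i.d. $\mathcal{CN}(0,1)$ entries and $\mathbf{D}$ is diagonal with $[\mathbf{D}]_{kk}=d_k^{-\alpha}$ ($d_k$ is the distance of user $k$, $\alpha$ the path-loss exponent). Put $\Sigma=\mathbf{D}$. The noise at user $k$ is $n_k\sim\mathcal{CN}(0,\sigma_k^2)$, and $p$ is the transmit power. The $M$-PSK constellation is $\{e^{2\pi \mathrm{i} q/M}: q=0,\dots,M-1\}$, with equiprobable symbols. With zero-forcing precoding (precoder proportional to $\mathbf{H}^H(\mathbf{H}\mathbf{H}^H)^{-1}$) the received signal at user $k$ is $y_k=\beta[\mathbf{s}]_k+n_k$, where $[\cdot]_k$ denotes the $k$-th entry. A constant (averaged) power scaling factor is used: $$\beta=\frac{\sqrt{\dfrac{p}{\mathbf{s}^H\Sigma^{-1}\mathbf{s}}}\;\Gamma\!\left(\tfrac32-K+N\right)}{K\sqrt K\,(N-K)!},$$ where $\mathbf{s}\in\mathbb{C}^K$ is a vector of $M$-PSK symbols. Since the symbols have modulus one and $\Sigma$ is diagonal, $\mathbf{s}^H\Sigma^{-1}\mathbf{s}=\sum_{k=1}^K d_k^{\alpha}$, so $\beta$ does not depend on $\mathbf{s}$. Let $\mathbf{s}_1,\dots,\mathbf{s}_{M^N}$ enumerate all vectors of length $N$ with entries in the $M$-PSK constellation, and put $\mathbf{s}_{m,i}=\mathbf{s}_m-\mathbf{s}_i$.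 The average rate of user $k$ is $$R_k^{ZF,\mathrm{av}}=N\log_2 M-\log_2 e-\frac{1}{M^N}\sum_{m=1}^{M^N}\mathcal{E}_{n_k}\Big[\log_2\sum_{i=1}^{M^N}e^{-|\beta[\mathbf{s}_{m,i}]_k+n_k|^2/\sigma_k^2}\Big],$$ where $\mathcal{E}$ denotes expectation. *)

theory Defs
  imports "HOL-Probability.Probability"
begin

text \<open>
  Users are indexed by \<open>{1..K}\<close> and antennas by \<open>{1..N}\<close>. Vectors and matrices are functions
  on natural-number indices, with the index range carried explicitly.
\<close>

definition psk :: "nat \<Rightarrow> complex set" where
  "psk M = {exp (2 * of_real pi * \<i> * of_nat q / of_nat M) | q. q < M}"

definition psk_vectors :: "nat \<Rightarrow> nat \<Rightarrow> (nat \<Rightarrow> complex) set" where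
  "psk_vectors M n = ({1..n} \<rightarrow>\<^sub>E psk M)"

definition Sigma_mat :: "real \<Rightarrow> (nat \<Rightarrow> real) \<Rightarrow> nat \<Rightarrow> nat \<Rightarrow> complex" where
  "Sigma_mat \<alpha> d k l = (if k = l then of_real (d k powr (- \<alpha>)) else 0)"

text \<open>Written entrywise; \<open>Sigma_mat_mult_inv\<close> below shows that it is the inverse matrix.\<close>

definition Sigma_inv :: "real \<Rightarrow> (nat \<Rightarrow> real) \<Rightarrow> nat \<Rightarrow> nat \<Rightarrow> complex" where
  "Sigma_inv \<alpha> d k l = (if k = l then inverse (of_real (d k powr (- \<alpha>))) else 0)"

lemma Sigma_mat_mult_inv:
  assumes "\<And>k. k \<in> {1..K} \<Longrightarrow> d k > 0" "k \<in> {1..K}" "l \<in> {1..K}"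
  shows "(\<Sum>i=1..K. Sigma_mat \<alpha> d k i * Sigma_inv \<alpha> d i l) = (if k = l then 1 else 0)"
    and "(\<Sum>i=1..K. Sigma_inv \<alpha> d k i * Sigma_mat \<alpha> d i l) = (if k = l then 1 else 0)"
proof -
  have d: "d k > 0" using assms by blast
  have "(\<Sum>i=1..K. Sigma_mat \<alpha> d k i * Sigma_inv \<alpha> d i l) =
        (\<Sum>i=1..K. if i = k then Sigma_mat \<alpha> d k k * Sigma_inv \<alpha> d k l else 0)"
    by (rule sum.cong) (auto simp: Sigma_mat_def)
  also have "\<dots> = (if k = l then 1 else 0)"
    using assms(2) d by (cases "k = l") (auto simp: Sigma_mat_def Sigma_inv_def)
  finally show "(\<Sum>i=1..K. Sigma_mat \<alpha> d k i * Sigma_inv \<alpha> d i l) = (if k = l then 1 else 0)" .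
  have "(\<Sum>i=1..K. Sigma_inv \<alpha> d k i * Sigma_mat \<alpha> d i l) =
        (\<Sum>i=1..K. if i = k then Sigma_inv \<alpha> d k k * Sigma_mat \<alpha> d k l else 0)"
    by (rule sum.cong) (auto simp: Sigma_inv_def)
  also have "\<dots> = (if k = l then 1 else 0)"
    using assms(2) d by (cases "k = l") (auto simp: Sigma_mat_def Sigma_inv_def)
  finally show "(\<Sum>i=1..K. Sigma_inv \<alpha> d k i * Sigma_mat \<alpha> d i l) = (if k = l then 1 else 0)" .
qed

definition quad_form :: "nat \<Rightarrow> (nat \<Rightarrow> nat \<Rightarrow> complex) \<Rightarrow> (nat \<Rightarrow> complex) \<Rightarrow> complex" where
  "quad_form K A x = (\<Sum>k=1..K. \<Sum>l=1..K. cnj (x k) * A k l * x l)"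

lemma psk_norm: "z \<in> psk M \<Longrightarrow> cmod z = 1"
  by (auto simp: psk_def norm_exp_eq_Re)

lemma quad_form_Sigma_inv:
  assumes "\<And>k. k \<in> {1..K} \<Longrightarrow> d k > 0" "x \<in> psk_vectors M K"
  shows "quad_form K (Sigma_inv \<alpha> d) x = of_real (\<Sum>k=1..K. d k powr \<alpha>)"
proof -
  have "quad_form K (Sigma_inv \<alpha> d) x = (\<Sum>k=1..K. of_real (d k powr \<alpha>))"
    unfolding quad_form_def
  proof (rule sum.cong)
    fix k assume k: "k \<in> {1..K}"
    have "cmod (x k) = 1"
      using assms(2) k by (auto simp: psk_vectors_def intro!: psk_norm[of _ M])
    then have one: "cnj (x k) * x k = 1"
      by (metis complex_norm_square mult.commute of_real_1 one_power2)
    have "(\<Sum>l=1..K. cnj (x k) * Sigma_inv \<alpha> d k l * x l) =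
          (\<Sum>l=1..K. if l = k then cnj (x k) * Sigma_inv \<alpha> d k k * x k else 0)"
      by (rule sum.cong) (auto simp: Sigma_inv_def)
    also have "\<dots> = (cnj (x k) * x k) * inverse (of_real (d k powr (- \<alpha>)))"
      using k by (simp add: Sigma_inv_def)
    also have "\<dots> = of_real (d k powr \<alpha>)"
      by (simp add: one powr_minus)
    finally show "(\<Sum>l=1..K. cnj (x k) * Sigma_inv \<alpha> d k l * x l) = of_real (d k powr \<alpha>)" .
  qed simp
  then show ?thesis by simp
qed

text \<open>
  By \<open>quad_form_Sigma_inv\<close> the quadratic form is real for PSK vectors and \<open>Re\<close> loses nothing.
\<close>

definition zf_scaling ::
    "nat \<Rightarrow> nat \<Rightarrow> real \<Rightarrow> real \<Rightarrow> (nat \<Rightarrow> real) \<Rightarrow> (nat \<Rightarrow> complex) \<Rightarrow> real" where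
  "zf_scaling N K p \<alpha> d x =
     sqrt (p / Re (quad_form K (Sigma_inv \<alpha> d) x)) * Gamma (3/2 - real K + real N)
       / (real K * sqrt (real K) * fact (N - K))"

text \<open>
  \<open>X\<close> is distributed as \<open>CN(0, v)\<close>: the total variance \<open>v\<close> is split evenly between independent
  real and imaginary parts. Note that \<^const>\<open>normal_density\<close> takes the standard deviation.
\<close>

definition complex_normal :: "'a measure \<Rightarrow> ('a \<Rightarrow> complex) \<Rightarrow> real \<Rightarrow> bool" where
  "complex_normal P X v \<longleftrightarrow>
     prob_space.indep_var P borel (\<lambda>\<omega>. Re (X \<omega>)) borel (\<lambda>\<omega>. Im (X \<omega>)) \<and>
     distributed P lborel (\<lambda>\<omega>. Re (X \<omega>)) (\<lambda>t. ennreal (normal_density 0 (sqrt (v / 2)) t)) \<and>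
     distributed P lborel (\<lambda>\<omega>. Im (X \<omega>)) (\<lambda>t. ennreal (normal_density 0 (sqrt (v / 2)) t))"

text \<open>
  Below, \<open>s\<close> enumerates the PSK vectors of length \<open>N\<close>, \<open>b\<close> is the scaling factor, \<open>n\<close> the noise
  at user \<open>k\<close> and \<open>\<sigma>\<^sup>2\<close> its variance.
\<close>

definition rate_zf_av ::
    "'a measure \<Rightarrow> nat \<Rightarrow> nat \<Rightarrow> real \<Rightarrow> (nat \<Rightarrow> nat \<Rightarrow> complex) \<Rightarrow> ('a \<Rightarrow> complex) \<Rightarrow> real \<Rightarrow> nat \<Rightarrow> real"
  where
  "rate_zf_av P N M b s n \<sigma> k =
     real N * log 2 (real M) - log 2 (exp 1)
     - 1 / real (M ^ N) *
       (\<Sum>m=1..M^N. prob_space.expectation P (\<lambda>\<omega>.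
          log 2 (\<Sum>i=1..M^N. exp (- (cmod (of_real b * (s m k - s i k) + n \<omega>))\<^sup>2 / \<sigma>\<^sup>2))))"

definition rate_zf_bound ::
    "nat \<Rightarrow> nat \<Rightarrow> real \<Rightarrow> (nat \<Rightarrow> nat \<Rightarrow> complex) \<Rightarrow> (nat \<Rightarrow> nat) \<Rightarrow> real \<Rightarrow> nat \<Rightarrow> real"
  where
  "rate_zf_bound N M b s j \<sigma> k =
     real N * log 2 (real M) - log 2 (exp 1)
     - 1 / real (M ^ N) *
       (\<Sum>m=1..M^N.
          - ((cmod (of_real b * (s m k - s (j m) k)))\<^sup>2 + \<sigma>\<^sup>2) * (log 2 (exp 1) / \<sigma>\<^sup>2)
          + log 2 (1 + (\<Sum>i\<in>{1..M^N} - {j m}.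
              exp (- ((cmod (of_real b * (s m k - s i k)))\<^sup>2
                      - (cmod (of_real b * (s m k - s (j m) k)))\<^sup>2) / (2 * \<sigma>\<^sup>2)))))"

end

theory Submission
  imports Defs
begin

text \<open>
  Let \<open>C\<close> be the constellation, \<open>\<psi> z = ln (\<Sum>c\<in>C. exp (c \<bullet> z))\<close> and \<open>\<zeta>\<close> a standard Gaussian vector of
  \<open>\<complex> = \<real>\<^sup>2\<close>. The right-hand side is smallest when \<open>j m = m\<close>, and after rescaling by the noise level and
  grouping the vectors by their \<open>k\<close>-th entry the claim for that choice reads \<open>H 0 \<le> H B\<close>, where
  \<open>H r = (\<Sum>c\<in>C. E \<psi> (r \<zeta> + (B\<^sup>2 + r\<^sup>2) / 2 c) - r\<^sup>2 / 2)\<close>. Jensen's inequality is too weak here (it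
  yields \<open>\<sigma>\<^sup>2\<close> instead of \<open>2 \<sigma>\<^sup>2\<close> in the exponents), so one follows the path \<open>r \<in> [0, B]\<close>.

  With \<open>\<mu> = \<nabla>\<psi>\<close>, the posterior mean of the symbol, Gaussian integration by parts gives
  \<open>H' r = r (\<Sum>c\<in>C. E (\<mu> \<bullet> c - |\<mu>|\<^sup>2))\<close>. Along the path the signal amplitude \<open>(B\<^sup>2 + r\<^sup>2) / 2\<close> is at least
  the value \<open>r\<^sup>2\<close> that matches the noise, and this makes \<open>H'\<close> nonnegative: by a Gaussian shift it
  reduces to the pointwise inequality \<open>(\<Sum>c\<in>C. exp (l (c \<bullet> z)) (\<mu> z \<bullet> c - |\<mu> z|\<^sup>2)) \<ge> 0\<close> for \<open>l \<ge> 1\<close>, with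
  equality at \<open>l = 1\<close>. That is Chebyshev's correlation inequality, since the reflections of \<open>C\<close> show
  that \<open>c \<bullet> z\<close> and \<open>c \<bullet> \<mu> z\<close> order the points of \<open>C\<close> in the same way. Convexity of \<open>\<psi>\<close> turns the
  derivative into finite increments, so no differentiation under the integral is needed.
\<close>

section \<open>Reflection-symmetric constellations\<close>

text \<open>On the unit circle \<open>cnj e\<close> is the inverse of \<open>e\<close>, so the last
  assumption makes \<open>C\<close> a coset of a finite group of roots of unity. It supplies, for
  any two points of \<open>C\<close>, a symmetry of \<open>C\<close> that swaps them.\<close>

locale reflective_constellation =
  fixes C :: "complex set"
  assumes fin: "finite C" and nonempty: "C \<noteq> {}"
    and unit: "c \<in> C \<Longrightarrow> cmod c = 1"
    and reflection_closed: "c \<in> C \<Longrightarrow> d \<in> C \<Longrightarrow> e \<in> C \<Longrightarrow> c * d * cnj e \<in> C"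
begin

section \<open>The log-partition function and its gradient\<close>

definition part :: "complex \<Rightarrow> real" where
  "part z = (\<Sum>c\<in>C. exp (c \<bullet> z))"

text \<open>The gradient of \<open>ln (part z)\<close>. All points have modulus one, so the weights
  are proportional to \<open>exp (- (cmod (z - c))\<^sup>2 / 2)\<close>: this is the conditional
  mean of a uniform symbol observed as \<open>z\<close> in standard Gaussian noise.\<close>

definition mean :: "complex \<Rightarrow> complex" where
  "mean z = (\<Sum>c\<in>C. (exp (c \<bullet> z) / part z) *\<^sub>R c)"

lemma part_pos: "part z > 0"
  unfolding part_def by (rule sum_pos) (use fin nonempty in auto)

lemma sum_weights: "(\<Sum>c\<in>C. exp (c \<bullet> z) / part z) = 1"
  using part_pos[of z] by (simp add: sum_divide_distrib[symmetric] part_def[symmetric])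

lemma inner_mean: "mean z \<bullet> x = (\<Sum>c\<in>C. exp (c \<bullet> z) / part z * (c \<bullet> x))"
  by (simp add: mean_def inner_sum_left)

lemma norm_mean_le: "cmod (mean z) \<le> 1"
proof -
  have "cmod (mean z) \<le> (\<Sum>c\<in>C. cmod ((exp (c \<bullet> z) / part z) *\<^sub>R c))"
    unfolding mean_def by (rule norm_sum)
  also have "\<dots> = (\<Sum>c\<in>C. exp (c \<bullet> z) / part z)"
    by (rule sum.cong) (use part_pos[of z] unit in auto)
  finally show ?thesis by (simp add: sum_weights)
qed

lemma abs_mean_inner_le: "\<bar>mean z \<bullet> x\<bar> \<le> cmod x"
proof -
  have "\<bar>mean z \<bullet> x\<bar> \<le> cmod (mean z) * cmod x" by (rule Cauchy_Schwarz_ineq2)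
  also have "\<dots> \<le> 1 * cmod x" by (intro mult_right_mono norm_mean_le) auto
  finally show ?thesis by simp
qed

text \<open>Convexity as a tangent bound: \<open>part x / part z\<close> is the average of
  \<open>exp (c \<bullet> (x - z))\<close> under the weights at \<open>z\<close>, and Jensen's
  inequality bounds it below by the exponential of the average exponent.\<close>

lemma ln_part_tangent: "ln (part x) \<ge> ln (part z) + mean z \<bullet> (x - z)"
proof -
  define t where "t = mean z \<bullet> (x - z)"
  define w where "w c = exp (c \<bullet> z) / part z" for c
  have w: "w c \<ge> 0" for c using part_pos[of z] by (simp add: w_def)
  have sw: "sum w C = 1" unfolding w_def by (rule sum_weights)
  have st: "(\<Sum>c\<in>C. w c * (c \<bullet> (x - z))) = t"
    unfolding t_def inner_mean w_def ..
  \<comment> \<open>Jensen by hand: the tangent of \<open>exp\<close> at \<open>t\<close> is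
    averaged, and its linear term cancels because \<open>t\<close> is the weighted mean of the
    exponents.\<close>
  have "(\<Sum>c\<in>C. w c * (exp t * (1 + (c \<bullet> (x - z) - t)))) =
      exp t * (sum w C + (\<Sum>c\<in>C. w c * (c \<bullet> (x - z))) - t * sum w C)"
    by (simp add: ring_distribs sum.distrib sum_subtractf sum_distrib_left mult_ac del: inner_diff_right)
  then have "exp t = (\<Sum>c\<in>C. w c * (exp t * (1 + (c \<bullet> (x - z) - t))))"
    by (simp add: st sw)
  also have "\<dots> \<le> (\<Sum>c\<in>C. w c * (exp t * exp (c \<bullet> (x - z) - t)))"
    by (intro sum_mono mult_left_mono exp_ge_add_one_self w) auto
  also have "\<dots> = (\<Sum>c\<in>C. exp (c \<bullet> x) / part z)"
    by (rule sum.cong) (auto simp: w_def exp_add[symmetric] inner_diff_right)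
  also have "\<dots> = part x / part z" by (simp add: part_def sum_divide_distrib)
  finally have "part z * exp t \<le> part x" using part_pos[of z] by (simp add: field_simps)
  then have "ln (part z * exp t) \<le> ln (part x)"
    using part_pos[of z] part_pos[of x] by (subst ln_le_cancel_iff) auto
  then show ?thesis using part_pos[of z] by (simp add: ln_mult t_def)
qed

text \<open>Linear growth, which gives integrability against the Gaussian. The tangent at 0 bounds
  from below and the tangent at \<open>z\<close> from above; both slopes have norm at most
  one.\<close>

lemma abs_ln_part_le: "\<bar>ln (part z)\<bar> \<le> ln (card C) + cmod z"
proof -
  have p0: "part 0 = card C" by (simp add: part_def)
  have c1: "card C \<ge> 1" using fin nonempty by (simp add: Suc_le_eq card_gt_0_iff)
  have "ln (card C) \<ge> 0" using c1 by simp
  moreover have "ln (part z) \<ge> ln (card C) + mean 0 \<bullet> z"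
    using ln_part_tangent[of 0 z] by (simp add: p0)
  moreover have "ln (card C) \<ge> ln (part z) - mean z \<bullet> z"
    using ln_part_tangent[of z 0] by (simp add: p0)
  ultimately show ?thesis using abs_mean_inner_le[of 0 z] abs_mean_inner_le[of z z] by linarith
qed

text \<open>For distinct \<open>c, d\<close> the map \<open>e \<mapsto> c * d * cnj e\<close> is the reflection of the constellation
  that swaps \<open>c\<close> and \<open>d\<close>.\<close>

lemma mean_comonotone:
  assumes c: "c \<in> C" and d: "d \<in> C"
  shows "((c - d) \<bullet> z) * ((c - d) \<bullet> mean z) \<ge> 0"
proof (cases "c = d")
  case False
  define u where "u = c - d"
  define r where "r e = c * d * cnj e" for e
  have u0: "u \<noteq> 0" using False by (simp add: u_def)
  have cc: "c * cnj c = 1" "d * cnj d = 1"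
    using unit[OF c] unit[OF d] by (simp_all add: complex_norm_square[symmetric])
  have rC: "r e \<in> C" if "e \<in> C" for e using reflection_closed[OF c d that] by (simp add: r_def)
  have rr: "r (r e) = e" for e
  proof -
    have "r (r e) = (c * cnj c) * (d * cnj d) * e" by (simp add: r_def algebra_simps)
    then show ?thesis by (simp add: cc)
  qed
  have bij: "bij_betw r C C"
    by (rule bij_betw_byWitness[where f' = r]) (auto simp: rr rC)
  have ucn: "c * d * cnj u = - u"
  proof -
    have "c * d * cnj u = (c * cnj c) * d - (d * cnj d) * c" by (simp add: u_def algebra_simps)
    then show ?thesis by (simp add: cc u_def)
  qed
  have uu: "u * cnj u = of_real (u \<bullet> u)"
    by (simp add: complex_mult_cnj inner_complex_def power2_eq_square)
  \<comment> \<open>A point minus its mirror image is twice its projection onto \<open>u\<close>,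
    the normal of the mirror line.\<close>
  have dif: "e - r e = (2 * (u \<bullet> e) / (u \<bullet> u)) *\<^sub>R u" for e
  proof -
    have "cnj u * (e - r e) = cnj u * e - (c * d * cnj u) * cnj e"
      by (simp add: r_def algebra_simps)
    then have "cnj u * (e - r e) = cnj u * e + u * cnj e" by (simp add: ucn)
    also have "\<dots> = of_real (2 * (u \<bullet> e))"
      by (simp add: complex_eq_iff inner_complex_def algebra_simps)
    finally have "(u * cnj u) * (e - r e) = of_real (2 * (u \<bullet> e)) * u"
      by (simp add: algebra_simps)
    then show ?thesis using u0 unfolding uu by (simp add: scaleR_conv_of_real field_simps)
  qed
  have dz: "e \<bullet> z - r e \<bullet> z = 2 * (u \<bullet> e) * (u \<bullet> z) / (u \<bullet> u)" for e
  proof -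
    have "e \<bullet> z - r e \<bullet> z = (e - r e) \<bullet> z" by (simp add: inner_diff_left)
    also have "\<dots> = (2 * (u \<bullet> e) / (u \<bullet> u)) * (u \<bullet> z)"
      unfolding dif by simp
    finally show ?thesis by simp
  qed
  have du: "u \<bullet> r e = - (u \<bullet> e)" for e
  proof -
    have "u \<bullet> (e - r e) = (2 * (u \<bullet> e) / (u \<bullet> u)) * (u \<bullet> u)"
      unfolding dif by simp
    then have "u \<bullet> (e - r e) = 2 * (u \<bullet> e)" using u0 by simp
    then show ?thesis by (simp add: inner_diff_right)
  qed
  \<comment> \<open>\<open>S\<close> equals \<open>part z * (u \<bullet> mean z)\<close>. Adding its
    reflected copy pairs \<open>e\<close> with \<open>r e\<close>; by \<open>dz\<close>, each
    difference of exponentials then has the sign of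
    \<open>(u \<bullet> z) * (u \<bullet> e)\<close>.\<close>
  define S where "S = (\<Sum>e\<in>C. (u \<bullet> e) * exp (e \<bullet> z))"
  have "S = (\<Sum>e\<in>C. (u \<bullet> r e) * exp (r e \<bullet> z))"
    unfolding S_def by (rule sum.reindex_bij_betw[OF bij, symmetric])
  then have S2: "2 * S = (\<Sum>e\<in>C. (u \<bullet> e) * (exp (e \<bullet> z) - exp (r e \<bullet> z)))"
    unfolding S_def by (simp add: du sum_negf sum_subtractf algebra_simps)
  have "2 * ((u \<bullet> z) * S) = (u \<bullet> z) * (2 * S)" by simp
  also have "\<dots> = (\<Sum>e\<in>C. (u \<bullet> z) * (u \<bullet> e) * (exp (e \<bullet> z) - exp (r e \<bullet> z)))"
    unfolding S2 sum_distrib_left by (simp only: mult.assoc)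
  also have "\<dots> \<ge> 0"
  proof (rule sum_nonneg)
    fix e
    define v where "v = (u \<bullet> z) * (u \<bullet> e)"
    have uup: "u \<bullet> u > 0" using u0 by simp
    have eq: "e \<bullet> z - r e \<bullet> z = 2 * v / (u \<bullet> u)" by (simp add: dz v_def)
    have "v * (exp (e \<bullet> z) - exp (r e \<bullet> z)) \<ge> 0"
    proof (cases "v \<ge> 0")
      case True
      then have "e \<bullet> z \<ge> r e \<bullet> z" using eq uup
        by (metis diff_ge_0_iff_ge divide_nonneg_pos mult_nonneg_nonneg zero_le_numeral)
      then show ?thesis using True by simp
    next
      case False
      then have "e \<bullet> z - r e \<bullet> z \<le> 0" unfolding eq using uup by (simp add: divide_nonpos_pos)
      then show ?thesis using False by (simp add: mult_nonpos_nonpos)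
    qed
    then show "(u \<bullet> z) * (u \<bullet> e) * (exp (e \<bullet> z) - exp (r e \<bullet> z)) \<ge> 0" by (simp add: v_def)
  qed
  finally have nn: "(u \<bullet> z) * S \<ge> 0" by linarith
  have "u \<bullet> mean z = S / part z"
    by (simp add: inner_commute[of u] inner_mean S_def sum_divide_distrib)
       (simp add: inner_commute mult.commute)
  then show ?thesis using nn part_pos[of z] unfolding u_def[symmetric] by (simp add: divide_nonneg_pos)
qed simp

text \<open>At \<open>l = 1\<close> the sum vanishes by the definition of \<open>mean\<close> (this
  is \<open>qg\<close>). The remaining factor \<open>f\<close> increases with
  \<open>c \<bullet> z\<close>, and by \<open>mean_comonotone\<close> so does \<open>g\<close>,
  hence the two are nonnegatively correlated under the weights \<open>q\<close>.\<close>

lemma sum_tilted_ge: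
  assumes "l \<ge> 1"
  shows "(\<Sum>c\<in>C. exp (l * (c \<bullet> z)) * (mean z \<bullet> c - mean z \<bullet> mean z)) \<ge> 0"
proof -
  define w where "w = mean z"
  define q where "q c = exp (c \<bullet> z)" for c
  define f where "f c = exp ((l - 1) * (c \<bullet> z))" for c
  define g where "g c = w \<bullet> c" for c
  have qf: "exp (l * (c \<bullet> z)) = q c * f c" for c
    by (simp add: q_def f_def exp_add[symmetric] algebra_simps)
  have qg: "(\<Sum>c\<in>C. q c * g c) = part z * (w \<bullet> w)"
  proof -
    have "w \<bullet> w = (\<Sum>c\<in>C. q c / part z * g c)"
      unfolding g_def q_def using inner_mean[of z w] by (simp add: w_def inner_commute)
    then show ?thesis using part_pos[of z]
      by (simp add: sum_divide_distrib[symmetric] times_divide_eq_left)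
  qed
  \<comment> \<open>The symmetrised double sum behind Chebyshev's inequality; it expands to
    \<open>2 * (part z)\<^sup>2\<close> times the covariance of \<open>f\<close> and
    \<open>g\<close>. If \<open>c \<bullet> z = d \<bullet> z\<close>, the term is zero because
    \<open>f c = f d\<close>.\<close>
  have "0 \<le> (\<Sum>c\<in>C. \<Sum>d\<in>C. q c * q d * ((f c - f d) * (g c - g d)))"
  proof (intro sum_nonneg, rule mult_nonneg_nonneg)
    fix c d assume cd: "c \<in> C" "d \<in> C"
    have *: "(c \<bullet> z - d \<bullet> z) * (g c - g d) \<ge> 0"
      using mean_comonotone[OF cd, of z]
      by (simp add: g_def w_def inner_diff_left inner_diff_right inner_commute)
    show "(f c - f d) * (g c - g d) \<ge> 0"
    proof (cases "c \<bullet> z" "d \<bullet> z" rule: linorder_cases)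
      case less
      then have "g c - g d \<le> 0" using * by (simp add: zero_le_mult_iff)
      moreover have "f c - f d \<le> 0" using less assms by (simp add: f_def mult_left_mono)
      ultimately show ?thesis by (simp add: mult_nonpos_nonpos)
    next
      case greater
      then have "g c - g d \<ge> 0" using * by (simp add: zero_le_mult_iff)
      moreover have "f c - f d \<ge> 0" using greater assms by (simp add: f_def mult_left_mono)
      ultimately show ?thesis by simp
    qed (simp add: f_def)
  qed (simp_all add: q_def)
  also have "\<dots> = (\<Sum>c\<in>C. \<Sum>d\<in>C. (q c * f c * g c) * q d) - (\<Sum>c\<in>C. \<Sum>d\<in>C. (q c * f c) * (q d * g d))
      - (\<Sum>c\<in>C. \<Sum>d\<in>C. (q c * g c) * (q d * f d)) + (\<Sum>c\<in>C. \<Sum>d\<in>C. q c * (q d * f d * g d))"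
    by (simp add: sum.distrib[symmetric] sum_subtractf[symmetric] algebra_simps)
  also have "\<dots> = 2 * (part z * (\<Sum>c\<in>C. q c * f c * g c) - (\<Sum>c\<in>C. q c * f c) * (part z * (w \<bullet> w)))"
    by (simp add: sum_product[symmetric] qg) (simp add: q_def part_def[symmetric])
  also have "\<dots> = 2 * part z * (\<Sum>c\<in>C. q c * f c * (g c - w \<bullet> w))"
    by (simp add: algebra_simps sum_subtractf sum_distrib_left sum_distrib_right)
  finally show ?thesis using part_pos[of z] unfolding qf g_def w_def
    by (simp add: zero_le_mult_iff)
qed

end

section \<open>The standard Gaussian measure on the complex plane\<close>

definition gauss :: "real measure" where
  "gauss = density lborel std_normal_density"

lemma sets_gauss [measurable_cong, simp]: "sets gauss = sets borel"
  by (simp add: gauss_def)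

lemma space_gauss [simp]: "space gauss = UNIV"
  by (simp add: gauss_def)

interpretation gauss: prob_space gauss
  unfolding gauss_def by (rule prob_space_normal_density) simp

interpretation gauss2: pair_prob_space gauss gauss ..

lemma integral_gauss:
  fixes f :: "real \<Rightarrow> real"
  assumes [measurable]: "f \<in> borel_measurable borel"
  shows "(\<integral>x. f x \<partial>gauss) = (\<integral>x. std_normal_density x * f x \<partial>lborel)"
  unfolding gauss_def by (subst integral_density) auto

lemma integrable_gauss:
  fixes f :: "real \<Rightarrow> real"
  assumes [measurable]: "f \<in> borel_measurable borel"
  shows "integrable gauss f \<longleftrightarrow> integrable lborel (\<lambda>x. std_normal_density x * f x)"
  unfolding gauss_def by (subst integrable_density) auto

lemma std_normal_density_shift:
  "std_normal_density (x - a) = std_normal_density x * exp (a * x - a\<^sup>2 / 2)"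
  by (simp add: std_normal_density_def exp_add[symmetric] power2_eq_square field_simps)

text \<open>The Cameron-Martin formula, by translating Lebesgue measure. No integrability is
  assumed: for a non-integrable integrand both sides take the default value 0.\<close>

lemma integral_gauss_shift:
  fixes f :: "real \<Rightarrow> real"
  assumes [measurable]: "f \<in> borel_measurable borel"
  shows "(\<integral>x. f (x + a) \<partial>gauss) = (\<integral>x. f x * exp (a * x - a\<^sup>2 / 2) \<partial>gauss)"
proof -
  have "(\<integral>x. f x * exp (a * x - a\<^sup>2 / 2) \<partial>gauss) = (\<integral>x. std_normal_density (x - a) * f x \<partial>lborel)"
    by (subst integral_gauss) (auto simp: std_normal_density_shift mult_ac)
  also have "\<dots> = (\<integral>x. std_normal_density x * f (a + x) \<partial>lborel)"
    by (subst lborel_integral_real_affine[where c = 1 and t = a]) auto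
  also have "\<dots> = (\<integral>x. f (x + a) \<partial>gauss)"
    by (subst integral_gauss) (auto simp: add.commute)
  finally show ?thesis by simp
qed

lemma integrable_gauss_exp: "integrable gauss (\<lambda>x. exp (a * x))"
proof -
  have "std_normal_density x * exp (a * x) = exp (a\<^sup>2 / 2) * normal_density a 1 x" for x
    by (simp add: normal_density_def exp_add[symmetric] power2_eq_square field_simps)
  then show ?thesis
    by (subst integrable_gauss) auto
qed

lemma gauss_moments:
  "integrable gauss (\<lambda>x. x)" "integrable gauss (\<lambda>x. x\<^sup>2)"
  "(\<integral>x. x \<partial>gauss) = 0" "(\<integral>x. x\<^sup>2 \<partial>gauss) = 1"
  using integrable_std_normal_moment[of 1] integrable_std_normal_moment[of 2]
    integral_std_normal_moment_odd[of 0] integral_std_normal_moment_even[of 1]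
  by (simp_all add: integrable_gauss integral_gauss)

text \<open>Integration by parts: the density has derivative \<open>- x\<close> times itself, so the
  difference of the two integrands is the derivative of density times \<open>f\<close>, and the
  boundary values vanish because \<open>f\<close> is bounded.\<close>

lemma gauss_stein:
  fixes f f' :: "real \<Rightarrow> real"
  assumes deriv: "\<And>x. (f has_field_derivative f' x) (at x)"
    and cont: "\<And>x. isCont f' x"
    and bd: "\<And>x. \<bar>f x\<bar> \<le> K" "\<And>x. \<bar>f' x\<bar> \<le> K'"
  shows "(\<integral>x. x * f x \<partial>gauss) = (\<integral>x. f' x \<partial>gauss)"
proof -
  have contf: "isCont f x" for x using deriv DERIV_isCont by blast
  have [measurable]: "f \<in> borel_measurable borel" "f' \<in> borel_measurable borel"
    by (auto intro!: borel_measurable_continuous_onI continuous_at_imp_continuous_on contf cont)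
  let ?n = std_normal_density
  have dn: "(?n has_field_derivative - x * ?n x) (at x)" for x
    unfolding std_normal_density_def
    by (auto intro!: derivative_eq_intros simp: field_simps)
  have cn: "isCont ?n x" for x using dn DERIV_isCont by blast
  have i1: "integrable gauss (\<lambda>x. x * f x)"
    by (rule Bochner_Integration.integrable_bound[OF integrable_mult_left[OF gauss_moments(1), of K]])
      (auto simp: abs_mult intro!: mult_left_mono order_trans[OF bd(1) abs_ge_self])
  have i2: "integrable gauss f'"
    by (rule gauss.integrable_const_bound[where B = K']) (auto simp: bd)
  have l1: "integrable lborel (\<lambda>x. ?n x * (x * f x))" using i1 by (simp add: integrable_gauss)
  have l2: "integrable lborel (\<lambda>x. ?n x * f' x)" using i2 by (simp add: integrable_gauss)
  define g where "g x = ?n x * f' x - ?n x * (x * f x)" for x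
  \<comment> \<open>Stated for any filter along which \<open>x\<^sup>2\<close> tends to infinity, so
    that it covers both ends of the line.\<close>
  have lim: "((\<lambda>x. ?n x * f x) \<longlongrightarrow> 0) F" if F: "filterlim (\<lambda>x::real. x\<^sup>2) at_top F" for F
  proof (rule Lim_null_comparison)
    show "\<forall>\<^sub>F x in F. norm (?n x * f x) \<le> ?n x * K"
      by (auto simp: abs_mult intro!: always_eventually mult_left_mono bd)
    have "((\<lambda>x. exp (- (x\<^sup>2 / 2))) \<longlongrightarrow> 0) F"
      by (rule filterlim_compose[OF exp_at_bot] filterlim_compose[OF filterlim_uminus_at_bot_at_top])+
         (use filterlim_tendsto_pos_mult_at_top[OF tendsto_const[of "1/2"] _ F] in simp)
    then show "((\<lambda>x. ?n x * K) \<longlongrightarrow> 0) F"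
      using tendsto_mult_right_zero[of _ F "K / sqrt (2 * pi)"]
      by (simp add: std_normal_density_def mult_ac)
  qed
  have "(LBINT x=-\<infinity>..\<infinity>. g x) = 0 - 0"
  proof (rule interval_integral_FTC_integrable[where F = "\<lambda>x. ?n x * f x"])
    show "((\<lambda>x. ?n x * f x) has_vector_derivative g x) (at x)" for x
      unfolding has_real_derivative_iff_has_vector_derivative[symmetric] g_def
      by (auto intro!: derivative_eq_intros dn deriv simp: algebra_simps)
    show "isCont g x" for x
      unfolding g_def by (intro continuous_intros cn contf cont)
    show "set_integrable lborel (einterval (-\<infinity>) \<infinity>) g"
      unfolding set_integrable_def g_def using l1 l2 by simp
    show "(((\<lambda>x. ?n x * f x) \<circ> real_of_ereal) \<longlongrightarrow> 0) (at_right (-\<infinity>))"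
      unfolding ereal_tendsto_simps
      by (intro lim filterlim_pow_at_bot_even filterlim_ident) auto
    show "(((\<lambda>x. ?n x * f x) \<circ> real_of_ereal) \<longlongrightarrow> 0) (at_left \<infinity>)"
      unfolding ereal_tendsto_simps
      by (intro lim filterlim_pow_at_top filterlim_ident) auto
  qed simp
  then have "(\<integral>x. g x \<partial>lborel) = 0"
    by (simp add: interval_lebesgue_integral_def set_lebesgue_integral_def)
  then show ?thesis
    unfolding g_def using l1 l2 by (simp add: integral_gauss)
qed

section \<open>The Gaussian on the plane, reduced to the line by Fubini\<close>

definition cgauss :: "complex measure" where
  "cgauss = distr (gauss \<Otimes>\<^sub>M gauss) borel (\<lambda>(x, y). Complex x y)"

lemma measurable_Complex [measurable]:
  "(\<lambda>(x, y). Complex x y) \<in> borel_measurable (borel \<Otimes>\<^sub>M borel)"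
  by (simp add: Complex_eq split_beta)

lemma sets_cgauss [measurable_cong, simp]: "sets cgauss = sets borel"
  by (simp add: cgauss_def)

lemma space_cgauss [simp]: "space cgauss = UNIV"
  by (simp add: cgauss_def)

interpretation cgauss: prob_space cgauss
  unfolding cgauss_def by (intro gauss2.prob_space_distr) simp

lemma integral_cgauss:
  fixes f :: "complex \<Rightarrow> real"
  assumes [measurable]: "f \<in> borel_measurable borel"
  shows "(\<integral>z. f z \<partial>cgauss) = (\<integral>p. (case p of (x, y) \<Rightarrow> f (Complex x y)) \<partial>(gauss \<Otimes>\<^sub>M gauss))"
  unfolding cgauss_def by (subst integral_distr) (auto simp: split_beta')

lemma integrable_cgauss:
  fixes f :: "complex \<Rightarrow> real"
  assumes [measurable]: "f \<in> borel_measurable borel"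
  shows "integrable cgauss f \<longleftrightarrow> integrable (gauss \<Otimes>\<^sub>M gauss) (\<lambda>(x, y). f (Complex x y))"
  unfolding cgauss_def by (subst integrable_distr_eq) (auto simp: split_beta')

text \<open>Both orders are needed: integration by parts in one coordinate requires that coordinate
  in the inner integral.\<close>

lemma integral_cgauss_iterated:
  fixes f :: "complex \<Rightarrow> real"
  assumes "integrable cgauss f"
  shows "(\<integral>z. f z \<partial>cgauss) = (\<integral>x. (\<integral>y. f (Complex x y) \<partial>gauss) \<partial>gauss)"
    and "(\<integral>z. f z \<partial>cgauss) = (\<integral>y. (\<integral>x. f (Complex x y) \<partial>gauss) \<partial>gauss)"
proof -
  have m: "f \<in> borel_measurable borel"
    using borel_measurable_integrable[OF assms] by (simp cong: measurable_cong_sets)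
  have i: "integrable (gauss \<Otimes>\<^sub>M gauss) (\<lambda>(x, y). f (Complex x y))"
    using assms by (simp add: integrable_cgauss m)
  show "(\<integral>z. f z \<partial>cgauss) = (\<integral>x. (\<integral>y. f (Complex x y) \<partial>gauss) \<partial>gauss)"
    using gauss2.integral_fst[OF i] by (simp add: integral_cgauss m)
  show "(\<integral>z. f z \<partial>cgauss) = (\<integral>y. (\<integral>x. f (Complex x y) \<partial>gauss) \<partial>gauss)"
    using gauss2.integral_snd[OF i] by (simp add: integral_cgauss m)
qed

lemma integrable_cgauss_prod:
  fixes f g :: "real \<Rightarrow> real"
  assumes f: "integrable gauss f" and g: "integrable gauss g"
  shows "integrable cgauss (\<lambda>z. f (Re z) * g (Im z))"
proof -
  have [measurable]: "f \<in> borel_measurable borel" "g \<in> borel_measurable borel"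
    using borel_measurable_integrable[OF f] borel_measurable_integrable[OF g]
    by (simp_all cong: measurable_cong_sets)
  have "integrable (gauss \<Otimes>\<^sub>M gauss) (\<lambda>(x, y). f x * g y)"
    by (rule gauss2.Fubini_integrable) (use f g in \<open>auto simp: abs_mult\<close>)
  then show ?thesis by (subst integrable_cgauss) auto
qed

lemma integrable_cgauss_exp_inner: "integrable cgauss (\<lambda>z. exp (a \<bullet> z))"
  using integrable_cgauss_prod[OF integrable_gauss_exp[of "Re a"] integrable_gauss_exp[of "Im a"]]
  by (simp add: inner_complex_def exp_add)

text \<open>Each coordinate has variance one, so the total variance is 2: \<open>cgauss\<close> is
  the law CN(0, 2), not CN(0, 1).\<close>

lemma cgauss_moments:
  "integrable cgauss (\<lambda>z. a \<bullet> z)" "(\<integral>z. a \<bullet> z \<partial>cgauss) = 0"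
  "integrable cgauss (\<lambda>z. (cmod z)\<^sup>2)" "(\<integral>z. (cmod z)\<^sup>2 \<partial>cgauss) = 2"
proof -
  have c: "integrable gauss (\<lambda>x. 1::real)" by simp
  have 1: "integrable cgauss (\<lambda>z. Re z)" "integrable cgauss (\<lambda>z. Im z)"
    using integrable_cgauss_prod[OF gauss_moments(1) c] integrable_cgauss_prod[OF c gauss_moments(1)]
    by simp_all
  have 2: "integrable cgauss (\<lambda>z. (Re z)\<^sup>2)" "integrable cgauss (\<lambda>z. (Im z)\<^sup>2)"
    using integrable_cgauss_prod[OF gauss_moments(2) c] integrable_cgauss_prod[OF c gauss_moments(2)]
    by simp_all
  note int = integral_cgauss_iterated(1)[OF 1(1)] integral_cgauss_iterated(1)[OF 1(2)]
    integral_cgauss_iterated(1)[OF 2(1)] integral_cgauss_iterated(1)[OF 2(2)]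
  show "integrable cgauss (\<lambda>z. a \<bullet> z)" "(\<integral>z. a \<bullet> z \<partial>cgauss) = 0"
    unfolding inner_complex_def using 1 int gauss.prob_space by (simp_all add: gauss_moments)
  show "integrable cgauss (\<lambda>z. (cmod z)\<^sup>2)" "(\<integral>z. (cmod z)\<^sup>2 \<partial>cgauss) = 2"
    unfolding cmod_power2 using 2 int gauss.prob_space by (simp_all add: gauss_moments)
qed

lemma integrable_cgauss_cmod: "integrable cgauss (\<lambda>z. cmod z)"
proof (rule Bochner_Integration.integrable_bound)
  show "integrable cgauss (\<lambda>z. 1 + (cmod z)\<^sup>2)" using cgauss_moments(3) by simp
  have "r \<le> 1 + r\<^sup>2" if "r \<ge> 0" for r :: real
    using sum_squares_ge_zero[of "r - 1/2" 0] by (simp add: power2_eq_square algebra_simps)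
  then show "AE z in cgauss. norm (cmod z) \<le> norm (1 + (cmod z)\<^sup>2)" by simp
qed simp

text \<open>The planar Cameron-Martin formula, obtained by shifting one coordinate at a time.
  Boundedness of \<open>f\<close> provides the integrability that Fubini requires.\<close>

lemma integral_cgauss_shift:
  fixes f :: "complex \<Rightarrow> real"
  assumes [measurable]: "f \<in> borel_measurable borel" and bd: "\<And>z. \<bar>f z\<bar> \<le> K"
  shows "integrable cgauss (\<lambda>z. f z * exp (a \<bullet> z - a \<bullet> a / 2))"
    and "(\<integral>z. f (z + a) \<partial>cgauss) = (\<integral>z. f z * exp (a \<bullet> z - a \<bullet> a / 2) \<partial>cgauss)"
proof -
  have e: "integrable cgauss (\<lambda>z. K * (exp (a \<bullet> z) * exp (- (a \<bullet> a / 2))))"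
    using integrable_cgauss_exp_inner[of a] by simp
  show int: "integrable cgauss (\<lambda>z. f z * exp (a \<bullet> z - a \<bullet> a / 2))"
    by (rule Bochner_Integration.integrable_bound[OF e])
      (auto simp: abs_mult exp_add[symmetric] intro!: mult_right_mono order_trans[OF bd abs_ge_self])
  have int': "integrable cgauss (\<lambda>z. f (z + a))"
    by (rule cgauss.integrable_const_bound[where B = K]) (auto simp: bd)
  \<comment> \<open>The inner integral after the shift in the imaginary direction; the real
    direction is then a shift of \<open>h\<close>.\<close>
  define h where "h x = (\<integral>y. f (Complex x y) * exp (Im a * y - (Im a)\<^sup>2 / 2) \<partial>gauss)" for x
  have fC [measurable]: "(\<lambda>(x, y). f (Complex x y)) \<in> borel_measurable (borel \<Otimes>\<^sub>M borel)"
    unfolding Complex_eq split_beta by measurable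
  have fC' [measurable]: "(\<lambda>y. f (Complex x y)) \<in> borel_measurable borel" for x
    unfolding Complex_eq by measurable
  have [measurable]: "h \<in> borel_measurable borel"
    unfolding h_def by measurable
  have ca: "Complex x y + a = Complex (x + Re a) (y + Im a)" for x y
    by (simp add: complex_eq_iff)
  have "(\<integral>z. f (z + a) \<partial>cgauss) = (\<integral>x. (\<integral>y. f (Complex (x + Re a) (y + Im a)) \<partial>gauss) \<partial>gauss)"
    by (subst integral_cgauss_iterated(1)[OF int']) (simp add: ca)
  also have "\<dots> = (\<integral>x. h (x + Re a) \<partial>gauss)"
    unfolding h_def by (subst integral_gauss_shift) auto
  also have "\<dots> = (\<integral>x. h x * exp (Re a * x - (Re a)\<^sup>2 / 2) \<partial>gauss)"
    by (rule integral_gauss_shift) simp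
  also have "\<dots> = (\<integral>x. (\<integral>y. f (Complex x y) * exp (a \<bullet> Complex x y - a \<bullet> a / 2) \<partial>gauss) \<partial>gauss)"
    unfolding h_def integral_mult_left_zero[symmetric]
    by (intro Bochner_Integration.integral_cong)
       (simp_all add: inner_complex_def exp_add[symmetric] power2_eq_square field_simps)
  also have "\<dots> = (\<integral>z. f z * exp (a \<bullet> z - a \<bullet> a / 2) \<partial>cgauss)"
    by (rule integral_cgauss_iterated(1)[OF int, symmetric])
  finally show "(\<integral>z. f (z + a) \<partial>cgauss) = (\<integral>z. f z * exp (a \<bullet> z - a \<bullet> a / 2) \<partial>cgauss)" .
qed

text \<open>Freezing one coordinate reduces each claim to \<open>gauss_stein\<close> in the other,
  with \<open>f'\<close> as the partial derivative.\<close>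

lemma cgauss_stein:
  fixes f f' :: "complex \<Rightarrow> real"
  assumes contf: "continuous_on UNIV f" and contf': "continuous_on UNIV f'"
    and bd: "\<And>z. \<bar>f z\<bar> \<le> K" "\<And>z. \<bar>f' z\<bar> \<le> K'"
  shows cgauss_stein_Re:
      "(\<And>x y. ((\<lambda>t. f (Complex t y)) has_field_derivative f' (Complex x y)) (at x))
        \<Longrightarrow> (\<integral>z. Re z * f z \<partial>cgauss) = (\<integral>z. f' z \<partial>cgauss)"
    and cgauss_stein_Im:
      "(\<And>x y. ((\<lambda>t. f (Complex x t)) has_field_derivative f' (Complex x y)) (at y))
        \<Longrightarrow> (\<integral>z. Im z * f z \<partial>cgauss) = (\<integral>z. f' z \<partial>cgauss)"
proof -
  have [measurable]: "f \<in> borel_measurable borel" "f' \<in> borel_measurable borel"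
    using contf contf' by (auto intro!: borel_measurable_continuous_onI)
  have "integrable cgauss (\<lambda>z. 1 \<bullet> z)" "integrable cgauss (\<lambda>z. \<i> \<bullet> z)"
    by (rule cgauss_moments(1))+
  then have ri: "integrable cgauss Re" "integrable cgauss Im"
    by (simp_all add: inner_complex_def)
  have i1: "integrable cgauss (\<lambda>z. Re z * f z)"
    by (rule Bochner_Integration.integrable_bound[OF integrable_mult_left[OF ri(1), of K]])
      (auto simp: abs_mult intro!: mult_left_mono order_trans[OF bd(1) abs_ge_self])
  have i2: "integrable cgauss (\<lambda>z. Im z * f z)"
    by (rule Bochner_Integration.integrable_bound[OF integrable_mult_left[OF ri(2), of K]])
      (auto simp: abs_mult intro!: mult_left_mono order_trans[OF bd(1) abs_ge_self])
  have i': "integrable cgauss f'"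
    by (rule cgauss.integrable_const_bound[where B = K']) (auto simp: bd)
  have c: "isCont (\<lambda>t. f' (Complex t y)) x" "isCont (\<lambda>t. f' (Complex y t)) x" for x y
  proof -
    have "continuous_on UNIV (\<lambda>t. f' (Complex t y))" "continuous_on UNIV (\<lambda>t. f' (Complex y t))"
      unfolding Complex_eq
      by (rule continuous_on_compose2[OF contf'], intro continuous_intros, simp)+
    then show "isCont (\<lambda>t. f' (Complex t y)) x" "isCont (\<lambda>t. f' (Complex y t)) x"
      by (simp_all add: continuous_on_eq_continuous_at)
  qed
  {
    assume d: "\<And>x y. ((\<lambda>t. f (Complex t y)) has_field_derivative f' (Complex x y)) (at x)"
    have "(\<integral>z. Re z * f z \<partial>cgauss) = (\<integral>y. (\<integral>x. x * f (Complex x y) \<partial>gauss) \<partial>gauss)"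
      by (simp add: integral_cgauss_iterated(2)[OF i1])
    also have "\<dots> = (\<integral>y. (\<integral>x. f' (Complex x y) \<partial>gauss) \<partial>gauss)"
      by (subst gauss_stein[OF d c(1) bd]) simp
    also have "\<dots> = (\<integral>z. f' z \<partial>cgauss)"
      by (simp add: integral_cgauss_iterated(2)[OF i'])
    finally show "(\<integral>z. Re z * f z \<partial>cgauss) = (\<integral>z. f' z \<partial>cgauss)" .
  }
  {
    assume d: "\<And>x y. ((\<lambda>t. f (Complex x t)) has_field_derivative f' (Complex x y)) (at y)"
    have "(\<integral>z. Im z * f z \<partial>cgauss) = (\<integral>x. (\<integral>y. y * f (Complex x y) \<partial>gauss) \<partial>gauss)"
      by (simp add: integral_cgauss_iterated(1)[OF i2])
    also have "\<dots> = (\<integral>x. (\<integral>y. f' (Complex x y) \<partial>gauss) \<partial>gauss)"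
      by (subst gauss_stein[OF d c(2) bd]) simp
    also have "\<dots> = (\<integral>z. f' z \<partial>cgauss)"
      by (simp add: integral_cgauss_iterated(1)[OF i'])
    finally show "(\<integral>z. Im z * f z \<partial>cgauss) = (\<integral>z. f' z \<partial>cgauss)" .
  }
qed

section \<open>Monotonicity along the path\<close>

context reflective_constellation
begin

section \<open>Posterior covariance and the two directions of motion\<close>

definition var :: "complex \<Rightarrow> complex \<Rightarrow> real" where
  "var u z = (\<Sum>c\<in>C. exp (c \<bullet> z) / part z * (c \<bullet> u)\<^sup>2) - (mean z \<bullet> u)\<^sup>2"

text \<open>The trace of the covariance matrix of the symbol, that is, mean square minus squared
  mean; the mean square is one by \<open>unit\<close>.\<close>

lemma var_total: "var 1 z + var \<i> z = 1 - mean z \<bullet> mean z"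
proof -
  have "(\<Sum>c\<in>C. exp (c \<bullet> z) / part z * (c \<bullet> 1)\<^sup>2) + (\<Sum>c\<in>C. exp (c \<bullet> z) / part z * (c \<bullet> \<i>)\<^sup>2)
      = (\<Sum>c\<in>C. exp (c \<bullet> z) / part z * ((Re c)\<^sup>2 + (Im c)\<^sup>2))"
    by (simp add: sum.distrib[symmetric] inner_complex_def ring_distribs add_divide_distrib)
  also have "\<dots> = (\<Sum>c\<in>C. exp (c \<bullet> z) / part z)"
    by (rule sum.cong) (use unit in \<open>auto simp: cmod_power2[symmetric]\<close>)
  finally have "(\<Sum>c\<in>C. exp (c \<bullet> z) / part z * (c \<bullet> 1)\<^sup>2) + (\<Sum>c\<in>C. exp (c \<bullet> z) / part z * (c \<bullet> \<i>)\<^sup>2) = 1"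
    by (simp only: sum_weights)
  moreover have "(mean z \<bullet> 1)\<^sup>2 + (mean z \<bullet> \<i>)\<^sup>2 = mean z \<bullet> mean z"
    by (simp add: inner_complex_def power2_eq_square)
  ultimately show ?thesis unfolding var_def by linarith
qed

lemma continuous_part: "continuous_on S part"
  unfolding part_def by (intro continuous_intros)

lemma continuous_mean: "continuous_on S mean"
  unfolding mean_def using part_pos
  by (intro continuous_intros continuous_part) (auto simp: less_imp_neq[symmetric])

lemma continuous_var: "continuous_on S (var u)"
  unfolding var_def using part_pos
  by (intro continuous_intros continuous_part continuous_mean) (auto simp: less_imp_neq[symmetric])

lemma borel_measurable_part [measurable]: "part \<in> borel_measurable borel"
  and borel_measurable_mean [measurable]: "mean \<in> borel_measurable borel"
  by (rule borel_measurable_continuous_onI continuous_part continuous_mean)+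

lemma mean_inner_mean_le: "mean z \<bullet> mean z \<le> 1"
  using norm_mean_le[of z] by (simp add: dot_square_norm power_le_one)

lemma abs_var_le:
  assumes "cmod u = 1"
  shows "\<bar>var u z\<bar> \<le> 1"
proof -
  have le1: "(x \<bullet> u)\<^sup>2 \<le> 1" if "cmod x \<le> 1" for x
  proof -
    have "\<bar>x \<bullet> u\<bar> \<le> cmod x * cmod u" by (rule Cauchy_Schwarz_ineq2)
    then have "\<bar>x \<bullet> u\<bar> \<le> 1" using that assms by simp
    then show ?thesis by (simp add: abs_square_le_1)
  qed
  have "(\<Sum>c\<in>C. exp (c \<bullet> z) / part z * (c \<bullet> u)\<^sup>2) \<le> (\<Sum>c\<in>C. exp (c \<bullet> z) / part z * 1)"
    using part_pos[of z] unit by (intro sum_mono mult_left_mono le1) auto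
  then have "(\<Sum>c\<in>C. exp (c \<bullet> z) / part z * (c \<bullet> u)\<^sup>2) \<le> 1"
    by (simp only: mult_1_right sum_weights)
  moreover have "(\<Sum>c\<in>C. exp (c \<bullet> z) / part z * (c \<bullet> u)\<^sup>2) \<ge> 0"
    using part_pos[of z] by (intro sum_nonneg) auto
  moreover have "(mean z \<bullet> u)\<^sup>2 \<le> 1" "(mean z \<bullet> u)\<^sup>2 \<ge> 0"
    using le1[OF norm_mean_le] by auto
  ultimately show ?thesis unfolding var_def by linarith
qed

text \<open>The Hessian of \<open>ln (part z)\<close> is the covariance of the weights: this is the
  quotient rule for \<open>Q / part\<close>. Allowing a curve \<open>z\<close> lets one statement
  serve both coordinate directions.\<close>

lemma has_derivative_mean_inner:
  assumes z: "(z has_vector_derivative r *\<^sub>R u) (at t)"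
  shows "((\<lambda>t. mean (z t) \<bullet> u) has_field_derivative r * var u (z t)) (at t)"
proof -
  define Q where "Q x = (\<Sum>c\<in>C. exp (c \<bullet> x) * (c \<bullet> u))" for x
  define Q2 where "Q2 x = (\<Sum>c\<in>C. exp (c \<bullet> x) * (c \<bullet> u)\<^sup>2)" for x
  have d: "((\<lambda>t. c \<bullet> z t) has_field_derivative r * (c \<bullet> u)) (at t)" for c
    using bounded_linear.has_vector_derivative[OF bounded_linear_inner_right[of c] z]
    by (simp add: has_real_derivative_iff_has_vector_derivative)
  have de: "((\<lambda>t. exp (c \<bullet> z t)) has_field_derivative exp (c \<bullet> z t) * (r * (c \<bullet> u))) (at t)" for c
    by (rule DERIV_chain2[OF DERIV_exp d])
  have "((\<lambda>t. part (z t)) has_field_derivative (\<Sum>c\<in>C. exp (c \<bullet> z t) * (r * (c \<bullet> u)))) (at t)"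
    unfolding part_def by (rule DERIV_sum) (rule de)
  moreover have "(\<Sum>c\<in>C. exp (c \<bullet> z t) * (r * (c \<bullet> u))) = r * Q (z t)"
    unfolding Q_def sum_distrib_left by (rule sum.cong) auto
  ultimately have dp: "((\<lambda>t. part (z t)) has_field_derivative r * Q (z t)) (at t)" by simp
  have "((\<lambda>t. Q (z t)) has_field_derivative (\<Sum>c\<in>C. exp (c \<bullet> z t) * (r * (c \<bullet> u)) * (c \<bullet> u))) (at t)"
    unfolding Q_def by (rule DERIV_sum) (rule DERIV_cmult_right[OF de])
  moreover have "(\<Sum>c\<in>C. exp (c \<bullet> z t) * (r * (c \<bullet> u)) * (c \<bullet> u)) = r * Q2 (z t)"
    unfolding Q2_def sum_distrib_left by (rule sum.cong) (auto simp: power2_eq_square)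
  ultimately have dq: "((\<lambda>t. Q (z t)) has_field_derivative r * Q2 (z t)) (at t)" by simp
  have mQ: "mean x \<bullet> u = Q x / part x" for x
    by (simp add: inner_mean Q_def sum_divide_distrib)
  have vQ: "var u x = Q2 x / part x - (Q x / part x)\<^sup>2" for x
    by (simp add: var_def mQ Q2_def sum_divide_distrib)
  have p0: "part (z t) \<noteq> 0" using part_pos[of "z t"] by simp
  show ?thesis
    unfolding mQ vQ
    by (rule derivative_eq_intros dp dq refl p0)+ (use p0 in \<open>simp add: field_simps power2_eq_square\<close>)
qed

text \<open>Integration by parts in both coordinates turns the factor \<open>z\<close> into the
  divergence of the shifted mean, which is \<open>r\<close> times the trace computed in
  \<open>var_total\<close>.\<close>

lemma integral_mean_inner_gauss:
  "(\<integral>z. mean (r *\<^sub>R z + a) \<bullet> z \<partial>cgauss) = r * (\<integral>z. 1 - mean (r *\<^sub>R z + a) \<bullet> mean (r *\<^sub>R z + a) \<partial>cgauss)"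
proof -
  define f where "f u z = mean (r *\<^sub>R z + a) \<bullet> u" for u z
  define f' where "f' u z = r * var u (r *\<^sub>R z + a)" for u z
  have cf: "continuous_on UNIV (f u)" for u
    unfolding f_def
    by (intro continuous_intros continuous_on_compose2[OF continuous_mean[of UNIV]]) auto
  have cf': "continuous_on UNIV (f' u)" for u
    unfolding f'_def
    by (intro continuous_intros continuous_on_compose2[OF continuous_var[of UNIV]]) auto
  have [measurable]: "f u \<in> borel_measurable borel" "f' u \<in> borel_measurable borel" for u
    using cf cf' by (auto intro: borel_measurable_continuous_onI)
  have bf: "\<bar>f u z\<bar> \<le> 1" if "cmod u = 1" for u z
    using abs_mean_inner_le[of _ u] that by (simp add: f_def)
  have bf': "\<bar>f' u z\<bar> \<le> \<bar>r\<bar>" if "cmod u = 1" for u z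
    using mult_left_mono[OF abs_var_le[OF that], of "\<bar>r\<bar>"] by (simp add: f'_def abs_mult)
  have 1: "(\<integral>z. Re z * f 1 z \<partial>cgauss) = (\<integral>z. f' 1 z \<partial>cgauss)"
  proof (rule cgauss_stein_Re[OF cf cf' bf bf'])
    show "((\<lambda>t. f 1 (Complex t y)) has_real_derivative f' 1 (Complex x y)) (at x)" for x y
      unfolding f_def f'_def Complex_eq
      by (intro has_derivative_mean_inner) (auto intro!: derivative_eq_intros)
  qed auto
  have 2: "(\<integral>z. Im z * f \<i> z \<partial>cgauss) = (\<integral>z. f' \<i> z \<partial>cgauss)"
  proof (rule cgauss_stein_Im[OF cf cf' bf bf'])
    show "((\<lambda>t. f \<i> (Complex x t)) has_real_derivative f' \<i> (Complex x y)) (at y)" for x y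
      unfolding f_def f'_def Complex_eq
      by (intro has_derivative_mean_inner) (auto intro!: derivative_eq_intros)
  qed auto
  have i': "integrable cgauss (f' u)" if "cmod u = 1" for u
    by (rule cgauss.integrable_const_bound[where B = "\<bar>r\<bar>"]) (auto simp: bf'[OF that])
  have "\<bar>Re z * f 1 z\<bar> \<le> cmod z" "\<bar>Im z * f \<i> z\<bar> \<le> cmod z" for z
    using mult_mono[OF abs_Re_le_cmod[of z] bf[of 1 z]] mult_mono[OF abs_Im_le_cmod[of z] bf[of \<i> z]]
    by (simp_all add: abs_mult)
  then have i1: "integrable cgauss (\<lambda>z. Re z * f 1 z)" "integrable cgauss (\<lambda>z. Im z * f \<i> z)"
    by (auto intro!: Bochner_Integration.integrable_bound[OF integrable_cgauss_cmod])
  have "(\<integral>z. mean (r *\<^sub>R z + a) \<bullet> z \<partial>cgauss) = (\<integral>z. Re z * f 1 z + Im z * f \<i> z \<partial>cgauss)"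
    by (simp add: f_def inner_complex_def mult.commute)
  also have "\<dots> = (\<integral>z. f' 1 z + f' \<i> z \<partial>cgauss)"
    using i1 i' by (simp add: 1 2)
  also have "\<dots> = (\<integral>z. r * (1 - mean (r *\<^sub>R z + a) \<bullet> mean (r *\<^sub>R z + a)) \<partial>cgauss)"
    by (simp add: f'_def var_total distrib_left[symmetric])
  finally show ?thesis by simp
qed

text \<open>Since \<open>r z + m c = r (z + (m / r) c)\<close>, a Gaussian shift by
  \<open>(m / r) c\<close> moves the dependence on the symbol out of \<open>mean\<close> into an
  exponential weight. The sum over \<open>c\<close> is then nonnegative pointwise.\<close>

lemma sum_integral_mean_signal_ge:
  assumes r: "r \<noteq> 0" and m: "r\<^sup>2 \<le> m"
  shows "(\<Sum>c\<in>C. \<integral>z. mean (r *\<^sub>R z + m *\<^sub>R c) \<bullet> c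
    - mean (r *\<^sub>R z + m *\<^sub>R c) \<bullet> mean (r *\<^sub>R z + m *\<^sub>R c) \<partial>cgauss) \<ge> 0"
proof -
  define f where "f c z = mean (r *\<^sub>R z) \<bullet> c - mean (r *\<^sub>R z) \<bullet> mean (r *\<^sub>R z)" for c z
  define a where "a c = (m / r) *\<^sub>R c" for c :: complex
  have [measurable]: "f c \<in> borel_measurable borel" for c unfolding f_def by measurable
  have bd: "\<bar>f c z\<bar> \<le> 2" if "c \<in> C" for c z
    using abs_mean_inner_le[of "r *\<^sub>R z" c] unit[OF that] mean_inner_mean_le[of "r *\<^sub>R z"]
      inner_ge_zero[of "mean (r *\<^sub>R z)"]
    unfolding f_def by linarith
  have "(\<Sum>c\<in>C. \<integral>z. mean (r *\<^sub>R z + m *\<^sub>R c) \<bullet> c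
      - mean (r *\<^sub>R z + m *\<^sub>R c) \<bullet> mean (r *\<^sub>R z + m *\<^sub>R c) \<partial>cgauss) = (\<Sum>c\<in>C. \<integral>z. f c (z + a c) \<partial>cgauss)"
    using r by (simp add: f_def a_def scaleR_add_right)
  also have "\<dots> = (\<Sum>c\<in>C. \<integral>z. f c z * exp (a c \<bullet> z - a c \<bullet> a c / 2) \<partial>cgauss)"
    by (intro sum.cong refl integral_cgauss_shift(2)) (auto intro: bd)
  also have "\<dots> = (\<integral>z. (\<Sum>c\<in>C. f c z * exp (a c \<bullet> z - a c \<bullet> a c / 2)) \<partial>cgauss)"
    by (intro Bochner_Integration.integral_sum[symmetric] integral_cgauss_shift(1)) (auto intro: bd)
  also have "\<dots> \<ge> 0"
  proof (rule Bochner_Integration.integral_nonneg)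
    fix z
    \<comment> \<open>The ratio of signal amplitude to its matched value \<open>r\<^sup>2\<close>.
      The part of the weight that is quadratic in the shift is the same for all symbols and factors
      out.\<close>
    define l where "l = m / r\<^sup>2"
    have l: "l \<ge> 1" using r m by (simp add: l_def)
    have "(\<Sum>c\<in>C. f c z * exp (a c \<bullet> z - a c \<bullet> a c / 2)) =
        exp (- (m / r)\<^sup>2 / 2) * (\<Sum>c\<in>C. exp (l * (c \<bullet> (r *\<^sub>R z))) * f c z)"
      unfolding sum_distrib_left
    proof (rule sum.cong)
      fix c assume "c \<in> C"
      then have "c \<bullet> c = 1" using unit by (simp add: dot_square_norm)
      then have "a c \<bullet> z - a c \<bullet> a c / 2 = - (m / r)\<^sup>2 / 2 + l * (c \<bullet> (r *\<^sub>R z))"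
        using r by (simp add: a_def l_def power2_eq_square)
      then show "f c z * exp (a c \<bullet> z - a c \<bullet> a c / 2) =
          exp (- (m / r)\<^sup>2 / 2) * (exp (l * (c \<bullet> (r *\<^sub>R z))) * f c z)"
        by (simp only: exp_add) simp
    qed simp
    also have "\<dots> \<ge> 0"
      unfolding f_def by (intro mult_nonneg_nonneg sum_tilted_ge l) auto
    finally show "0 \<le> (\<Sum>c\<in>C. f c z * exp (a c \<bullet> z - a c \<bullet> a c / 2))" .
  qed
  finally show ?thesis .
qed

section \<open>The path functional and its increments\<close>

lemma integrable_ln_part: "integrable cgauss (\<lambda>z. ln (part (r *\<^sub>R z + a)))"
proof (rule Bochner_Integration.integrable_bound)
  show "integrable cgauss (\<lambda>z. ln (card C) + (\<bar>r\<bar> * cmod z + cmod a))"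
    using integrable_cgauss_cmod by simp
  have "\<bar>ln (part (r *\<^sub>R z + a))\<bar> \<le> ln (card C) + (\<bar>r\<bar> * cmod z + cmod a)" for z
    using abs_ln_part_le[of "r *\<^sub>R z + a"] norm_triangle_ineq[of "r *\<^sub>R z" a] by simp
  then show "AE z in cgauss. norm (ln (part (r *\<^sub>R z + a))) \<le> norm (ln (card C) + (\<bar>r\<bar> * cmod z + cmod a))"
    by (auto intro!: order_trans[OF _ abs_ge_self])
qed simp

text \<open>The function \<open>H\<close> of the overview. At \<open>r = B\<close> noise and signal
  are those of the rate; at \<open>r = 0\<close> the noise is gone and half the amplitude is left,
  which gives the bound.\<close>

definition pathval :: "real \<Rightarrow> real \<Rightarrow> real" where
  "pathval B r = (\<Sum>c\<in>C. (\<integral>z. ln (part (r *\<^sub>R z + ((B\<^sup>2 + r\<^sup>2) / 2) *\<^sub>R c)) \<partial>cgauss) - r\<^sup>2 / 2)"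

text \<open>The tangent bound at the old point is averaged along the displacement
  \<open>(s - r) z + \<delta> c\<close>: the noise part contributes
  \<open>(s - r) * r * (1 - e c)\<close>, the signal part \<open>\<delta> * t c\<close>. What is not
  nonnegative is quadratic in \<open>s - r\<close>.\<close>

lemma pathval_step:
  fixes B r s :: real
  assumes rB: "r\<^sup>2 \<le> B\<^sup>2" and rs: "r\<^sup>2 \<le> s\<^sup>2"
  shows "pathval B s \<ge> pathval B r - card C * (s - r)\<^sup>2"
proof -
  define m where "m = (B\<^sup>2 + r\<^sup>2) / 2"
  define \<delta> where "\<delta> = (s\<^sup>2 - r\<^sup>2) / 2"
  define M where "M c z = mean (r *\<^sub>R z + m *\<^sub>R c)" for c z
  define e where "e c = (\<integral>z. M c z \<bullet> M c z \<partial>cgauss)" for c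
  define t where "t c = (\<integral>z. M c z \<bullet> c \<partial>cgauss)" for c
  have [measurable]: "M c \<in> borel_measurable borel" for c unfolding M_def by measurable
  have i1: "integrable cgauss (\<lambda>z. M c z \<bullet> M c z)" for c
    by (rule cgauss.integrable_const_bound[where B = 1]) (auto simp: M_def mean_inner_mean_le)
  have i2: "integrable cgauss (\<lambda>z. M c z \<bullet> c)" for c
    by (rule cgauss.integrable_const_bound[where B = "cmod c"]) (auto simp: M_def abs_mean_inner_le)
  have i3: "integrable cgauss (\<lambda>z. M c z \<bullet> z)" for c
    by (rule Bochner_Integration.integrable_bound[OF integrable_cgauss_cmod])
      (auto simp: M_def abs_mean_inner_le)
  have e1: "e c \<le> 1" for c
  proof -
    have "e c \<le> (\<integral>z. 1 \<partial>cgauss)"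
      unfolding e_def by (intro Bochner_Integration.integral_mono i1) (auto simp: M_def mean_inner_mean_le)
    then show ?thesis using cgauss.prob_space by simp
  qed
  have e0: "e c \<ge> 0" for c unfolding e_def by simp
  have t1: "t c \<ge> - 1" if "c \<in> C" for c
  proof -
    have "- 1 \<le> M c z \<bullet> c" for z
      using abs_mean_inner_le[of "r *\<^sub>R z + m *\<^sub>R c" c] unit[OF that] unfolding M_def by linarith
    then have "(\<integral>z. - 1 \<partial>cgauss) \<le> t c"
      unfolding t_def by (intro Bochner_Integration.integral_mono i2) auto
    then show ?thesis using cgauss.prob_space by simp
  qed
  have step: "(\<integral>z. ln (part (s *\<^sub>R z + ((B\<^sup>2 + s\<^sup>2) / 2) *\<^sub>R c)) \<partial>cgauss) \<ge>
      (\<integral>z. ln (part (r *\<^sub>R z + m *\<^sub>R c)) \<partial>cgauss) + (s - r) * (r * (1 - e c)) + \<delta> * t c" for c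
  proof -
    have "(\<integral>z. ln (part (r *\<^sub>R z + m *\<^sub>R c)) \<partial>cgauss) + (s - r) * (r * (1 - e c)) + \<delta> * t c =
        (\<integral>z. ln (part (r *\<^sub>R z + m *\<^sub>R c)) + (s - r) * (M c z \<bullet> z) + \<delta> * (M c z \<bullet> c) \<partial>cgauss)"
      using integral_mean_inner_gauss[of r "m *\<^sub>R c"] integrable_ln_part[of r "m *\<^sub>R c"] i1[of c] i2[of c] i3[of c]
        cgauss.prob_space
      by (simp add: M_def[symmetric] e_def t_def)
    also have "\<dots> \<le> (\<integral>z. ln (part (s *\<^sub>R z + ((B\<^sup>2 + s\<^sup>2) / 2) *\<^sub>R c)) \<partial>cgauss)"
    proof (rule Bochner_Integration.integral_mono)
      fix z
      have "(s *\<^sub>R z + ((B\<^sup>2 + s\<^sup>2) / 2) *\<^sub>R c) - (r *\<^sub>R z + m *\<^sub>R c) = (s - r) *\<^sub>R z + \<delta> *\<^sub>R c"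
        by (simp add: m_def \<delta>_def complex_eq_iff field_simps)
      then show "ln (part (r *\<^sub>R z + m *\<^sub>R c)) + (s - r) * (M c z \<bullet> z) + \<delta> * (M c z \<bullet> c) \<le>
          ln (part (s *\<^sub>R z + ((B\<^sup>2 + s\<^sup>2) / 2) *\<^sub>R c))"
        using ln_part_tangent[of "r *\<^sub>R z + m *\<^sub>R c" "s *\<^sub>R z + ((B\<^sup>2 + s\<^sup>2) / 2) *\<^sub>R c"]
        by (simp add: M_def inner_add_right)
    qed (use integrable_ln_part i2 i3 in auto)
    finally show ?thesis .
  qed
  have \<delta>0: "\<delta> \<ge> 0" using rs by (simp add: \<delta>_def)
  have "pathval B s - pathval B r \<ge> (\<Sum>c\<in>C. (s - r) * (r * (1 - e c)) + \<delta> * t c - \<delta>)"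
  proof -
    have "pathval B s - pathval B r = (\<Sum>c\<in>C. ((\<integral>z. ln (part (s *\<^sub>R z + ((B\<^sup>2 + s\<^sup>2) / 2) *\<^sub>R c)) \<partial>cgauss) - s\<^sup>2 / 2)
        - ((\<integral>z. ln (part (r *\<^sub>R z + m *\<^sub>R c)) \<partial>cgauss) - r\<^sup>2 / 2))"
      by (simp add: pathval_def m_def sum_subtractf)
    also have "\<dots> \<ge> (\<Sum>c\<in>C. (s - r) * (r * (1 - e c)) + \<delta> * t c - \<delta>)"
    proof (rule sum_mono)
      fix c
      show "(s - r) * (r * (1 - e c)) + \<delta> * t c - \<delta> \<le>
          ((\<integral>z. ln (part (s *\<^sub>R z + ((B\<^sup>2 + s\<^sup>2) / 2) *\<^sub>R c)) \<partial>cgauss) - s\<^sup>2 / 2)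
          - ((\<integral>z. ln (part (r *\<^sub>R z + m *\<^sub>R c)) \<partial>cgauss) - r\<^sup>2 / 2)"
        using step[of c] by (simp add: \<delta>_def field_simps)
    qed
    finally show ?thesis .
  qed
  moreover have "(\<Sum>c\<in>C. (s - r) * (r * (1 - e c)) + \<delta> * t c - \<delta>) \<ge> - (card C * (s - r)\<^sup>2)"
  proof (cases "r = 0")
    case True
    have "(\<Sum>c\<in>C. - ((s - r)\<^sup>2)) \<le> (\<Sum>c\<in>C. (s - r) * (r * (1 - e c)) + \<delta> * t c - \<delta>)"
    proof (rule sum_mono)
      fix c assume "c \<in> C"
      then have "\<delta> * t c \<ge> \<delta> * (- 1)" using \<delta>0 t1 by (intro mult_left_mono) auto
      then show "- ((s - r)\<^sup>2) \<le> (s - r) * (r * (1 - e c)) + \<delta> * t c - \<delta>"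
        using True by (simp add: \<delta>_def)
    qed
    then show ?thesis by simp
  next
    case False
    have "r\<^sup>2 \<le> m" using rB by (simp add: m_def)
    from sum_integral_mean_signal_ge[OF False this] have "(\<Sum>c\<in>C. t c - e c) \<ge> 0"
      using i1 i2 by (simp add: M_def[symmetric] e_def t_def)
    then have te: "(\<Sum>c\<in>C. \<delta> * (t c - e c)) \<ge> 0"
      using \<delta>0 by (simp only: sum_distrib_left[symmetric] mult_nonneg_nonneg)
    \<comment> \<open>Uses \<open>\<delta> - (s - r) * r = (s - r)\<^sup>2 / 2\<close>: the
      first-order part is a multiple of \<open>t c - e c\<close>, whose sum is nonnegative.\<close>
    have eq: "(s - r) * (r * (1 - e c)) + \<delta> * t c - \<delta> =
        \<delta> * (t c - e c) - (s - r)\<^sup>2 / 2 * (1 - e c)" for c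
      by (simp add: \<delta>_def power2_eq_square field_simps)
    have "(\<Sum>c\<in>C. (s - r)\<^sup>2 / 2 * (1 - e c)) \<le> (\<Sum>c\<in>C. (s - r)\<^sup>2 * 1)"
      using e0 e1 by (intro sum_mono mult_mono) auto
    then show ?thesis
      using te by (simp add: eq sum_subtractf)
  qed
  ultimately show ?thesis by simp
qed

text \<open>With \<open>n\<close> equal steps from 0 to \<open>B\<close> the quadratic errors add up
  to \<open>K / n\<close>, which tends to 0.\<close>

lemma pathval_end_ge: "pathval B B \<ge> pathval B 0"
proof -
  define K where "K = card C * B\<^sup>2"
  have K: "K \<ge> 0" by (simp add: K_def)
  have *: "real n * (pathval B 0 - pathval B B) \<le> K" if n: "n > 0" for n
  proof -
    define x where "x k = real k * B / real n" for k
    have "pathval B (x k) \<ge> pathval B 0 - k * (card C * (B / n)\<^sup>2)" if "k \<le> n" for k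
      using that
    proof (induction k)
      case (Suc k)
      have q: "(real k / n)\<^sup>2 \<le> 1" "(real k / n)\<^sup>2 \<le> (real (Suc k) / n)\<^sup>2"
        using Suc.prems n by (auto simp: abs_square_le_1 intro!: power_mono divide_right_mono)
      have xs: "(x i)\<^sup>2 = (real i / n)\<^sup>2 * B\<^sup>2" for i by (simp add: x_def power_mult_distrib power_divide)
      have "(x k)\<^sup>2 \<le> B\<^sup>2" "(x k)\<^sup>2 \<le> (x (Suc k))\<^sup>2"
        unfolding xs using q mult_right_mono[OF q(1), of "B\<^sup>2"] mult_right_mono[OF q(2), of "B\<^sup>2"] by auto
      from pathval_step[OF this]
      have "pathval B (x (Suc k)) \<ge> pathval B (x k) - card C * (x (Suc k) - x k)\<^sup>2" .
      moreover have "x (Suc k) - x k = B / n" by (simp add: x_def add_divide_distrib ring_distribs)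
      ultimately show ?case using Suc by (simp add: algebra_simps)
    qed (simp add: x_def)
    from this[of n] have "pathval B B \<ge> pathval B 0 - n * (card C * (B / n)\<^sup>2)"
      using n by (simp add: x_def)
    moreover have "n * (card C * (B / n)\<^sup>2) = K / n"
      using n by (simp add: K_def power2_eq_square field_simps)
    ultimately have "pathval B 0 - pathval B B \<le> K / n" by linarith
    then show ?thesis using n by (simp add: field_simps)
  qed
  \<comment> \<open>The Archimedean rule concerns a nonnegative number, hence the truncation at
    0.\<close>
  have "max 0 (pathval B 0 - pathval B B) = 0"
    by (rule real_archimedian_rdiv_eq_0[where c = K]) (use * K in \<open>auto simp: max_def\<close>)
  then show ?thesis by linarith
qed

text \<open>The squares are expanded with \<open>c\<close> and \<open>i\<close> of modulus one;
  whatever does not depend on \<open>i\<close> leaves the logarithm. The remaining arguments of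
  \<open>part\<close> are the two ends of the path.\<close>

lemma ln_sum_exp_dist:
  assumes c: "c \<in> C"
  shows "ln (\<Sum>i\<in>C. exp (- (cmod (of_real B * (c - i) + z))\<^sup>2 / 2)) =
      ln (part (B *\<^sub>R z + B\<^sup>2 *\<^sub>R c)) - (B *\<^sub>R c) \<bullet> z - (cmod z)\<^sup>2 / 2 - B\<^sup>2"
    and "ln (\<Sum>i\<in>C. exp (- (cmod (of_real B * (c - i)))\<^sup>2 / 4)) = ln (part ((B\<^sup>2 / 2) *\<^sub>R c)) - B\<^sup>2 / 2"
proof -
  have sq: "(cmod x)\<^sup>2 = x \<bullet> x" for x by (simp add: dot_square_norm)
  have unit': "i \<bullet> i = 1" if "i \<in> C" for i using unit[OF that] by (simp add: dot_square_norm)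
  have lns: "ln (\<Sum>i\<in>C. exp (i \<bullet> w + k)) = ln (part w) + k" for w k
    using part_pos[of w] by (simp add: part_def exp_add sum_distrib_right[symmetric] ln_mult)
  have "(\<Sum>i\<in>C. exp (- (cmod (of_real B * (c - i) + z))\<^sup>2 / 2)) =
      (\<Sum>i\<in>C. exp (i \<bullet> (B *\<^sub>R z + B\<^sup>2 *\<^sub>R c) + (- ((B *\<^sub>R c) \<bullet> z) - (cmod z)\<^sup>2 / 2 - B\<^sup>2)))"
  proof (rule sum.cong)
    fix i assume i: "i \<in> C"
    have eq: "of_real B * (c - i) + z = B *\<^sub>R c - B *\<^sub>R i + z" by (simp add: scaleR_conv_of_real algebra_simps)
    have "- (cmod (of_real B * (c - i) + z))\<^sup>2 / 2 =
        i \<bullet> (B *\<^sub>R z + B\<^sup>2 *\<^sub>R c) + (- ((B *\<^sub>R c) \<bullet> z) - (cmod z)\<^sup>2 / 2 - B\<^sup>2)"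
      unfolding eq sq using unit'[OF c] unit'[OF i]
      by (simp add: inner_add_left inner_add_right inner_diff_left inner_diff_right inner_commute
          power2_eq_square field_simps)
    then show "exp (- (cmod (of_real B * (c - i) + z))\<^sup>2 / 2) =
        exp (i \<bullet> (B *\<^sub>R z + B\<^sup>2 *\<^sub>R c) + (- ((B *\<^sub>R c) \<bullet> z) - (cmod z)\<^sup>2 / 2 - B\<^sup>2))" by simp
  qed simp
  then show "ln (\<Sum>i\<in>C. exp (- (cmod (of_real B * (c - i) + z))\<^sup>2 / 2)) =
      ln (part (B *\<^sub>R z + B\<^sup>2 *\<^sub>R c)) - (B *\<^sub>R c) \<bullet> z - (cmod z)\<^sup>2 / 2 - B\<^sup>2"
    by (simp only: lns)
  have "(\<Sum>i\<in>C. exp (- (cmod (of_real B * (c - i)))\<^sup>2 / 4)) =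
      (\<Sum>i\<in>C. exp (i \<bullet> ((B\<^sup>2 / 2) *\<^sub>R c) + (- (B\<^sup>2 / 2))))"
  proof (rule sum.cong)
    fix i assume i: "i \<in> C"
    have eq: "of_real B * (c - i) = B *\<^sub>R c - B *\<^sub>R i" by (simp add: scaleR_conv_of_real algebra_simps)
    have "- (cmod (of_real B * (c - i)))\<^sup>2 / 4 = i \<bullet> ((B\<^sup>2 / 2) *\<^sub>R c) + (- (B\<^sup>2 / 2))"
      unfolding eq sq using unit'[OF c] unit'[OF i]
      by (simp add: inner_diff_left inner_diff_right inner_commute power2_eq_square field_simps)
    then show "exp (- (cmod (of_real B * (c - i)))\<^sup>2 / 4) = exp (i \<bullet> ((B\<^sup>2 / 2) *\<^sub>R c) + (- (B\<^sup>2 / 2)))" by simp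
  qed simp
  then show "ln (\<Sum>i\<in>C. exp (- (cmod (of_real B * (c - i)))\<^sup>2 / 4)) = ln (part ((B\<^sup>2 / 2) *\<^sub>R c)) - B\<^sup>2 / 2"
    by (simp only: lns)
qed

lemma integrable_ln_sum_exp_dist:
  assumes "c \<in> C"
  shows "integrable cgauss (\<lambda>z. ln (\<Sum>i\<in>C. exp (- (cmod (of_real B * (c - i) + z))\<^sup>2 / 2)))"
  unfolding ln_sum_exp_dist(1)[OF assms]
  using integrable_ln_part[of B "B\<^sup>2 *\<^sub>R c"] cgauss_moments(1)[of "B *\<^sub>R c"] cgauss_moments(3)
  by simp

text \<open>The comparison of the two ends of the path in terms of distances. The constant 1 is half
  the mean of \<open>(cmod z)\<^sup>2\<close>; the term linear in \<open>z\<close> has mean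
  0.\<close>

lemma sum_integral_ln_sum_exp_dist_ge:
  "(\<Sum>c\<in>C. ln (\<Sum>i\<in>C. exp (- (cmod (of_real B * (c - i)))\<^sup>2 / 4)) - 1)
    \<le> (\<Sum>c\<in>C. \<integral>z. ln (\<Sum>i\<in>C. exp (- (cmod (of_real B * (c - i) + z))\<^sup>2 / 2)) \<partial>cgauss)"
proof -
  have "(\<integral>z. ln (\<Sum>i\<in>C. exp (- (cmod (of_real B * (c - i) + z))\<^sup>2 / 2)) \<partial>cgauss) =
      (\<integral>z. ln (part (B *\<^sub>R z + B\<^sup>2 *\<^sub>R c)) \<partial>cgauss) - 1 - B\<^sup>2" if "c \<in> C" for c
    unfolding ln_sum_exp_dist(1)[OF that]
    using integrable_ln_part[of B "B\<^sup>2 *\<^sub>R c"] cgauss_moments(1,2)[of "B *\<^sub>R c"]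
      cgauss_moments(3,4) cgauss.prob_space
    by simp
  then have "(\<Sum>c\<in>C. \<integral>z. ln (\<Sum>i\<in>C. exp (- (cmod (of_real B * (c - i) + z))\<^sup>2 / 2)) \<partial>cgauss) =
      (\<Sum>c\<in>C. (\<integral>z. ln (part (B *\<^sub>R z + B\<^sup>2 *\<^sub>R c)) \<partial>cgauss) - 1 - B\<^sup>2)"
    by (rule sum.cong[OF refl])
  moreover have "(\<Sum>c\<in>C. ln (\<Sum>i\<in>C. exp (- (cmod (of_real B * (c - i)))\<^sup>2 / 4)) - 1) =
      (\<Sum>c\<in>C. ln (part ((B\<^sup>2 / 2) *\<^sub>R c)) - B\<^sup>2 / 2 - 1)"
    by (rule sum.cong[OF refl]) (simp only: ln_sum_exp_dist(2))
  moreover have "(\<Sum>c\<in>C. ln (part ((B\<^sup>2 / 2) *\<^sub>R c))) \<le>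
      (\<Sum>c\<in>C. (\<integral>z. ln (part (B *\<^sub>R z + B\<^sup>2 *\<^sub>R c)) \<partial>cgauss) - B\<^sup>2 / 2)"
    using pathval_end_ge[of B] cgauss.prob_space by (simp add: pathval_def)
  ultimately show ?thesis
    by (simp add: sum_subtractf)
qed

end

section \<open>Rates with PSK inputs\<close>

lemma psk_eq_roots:
  assumes "M \<ge> 1"
  shows "psk M = {z. z ^ M = 1}"
  using complex_roots_unity[OF assms] by (auto simp: psk_def)

lemma reflective_constellation_psk:
  assumes "M \<ge> 1"
  shows "reflective_constellation (psk M)"
proof
  show "finite (psk M)"
    by (simp add: psk_def)
  show "psk M \<noteq> {}" "\<And>c d e. c \<in> psk M \<Longrightarrow> d \<in> psk M \<Longrightarrow> e \<in> psk M \<Longrightarrow> c * d * cnj e \<in> psk M"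
    unfolding psk_eq_roots[OF assms]
    by (auto intro: exI[of _ 1] simp: power_mult_distrib complex_cnj_power[symmetric])
qed (rule psk_norm)

text \<open>Each value of the \<open>k\<close>-th coordinate is taken by
  \<open>card C ^ (card I - 1)\<close> functions. The count comes from writing
  \<open>F (f k)\<close> as a product over \<open>I\<close> with factor 1 away from \<open>k\<close>
  and exchanging product and sum.\<close>

lemma sum_PiE_coordinate:
  fixes F :: "'b \<Rightarrow> real"
  assumes "finite I" "k \<in> I" "finite C"
  shows "(\<Sum>f\<in>I \<rightarrow>\<^sub>E C. F (f k)) = real (card C ^ (card I - 1)) * (\<Sum>c\<in>C. F c)"
proof -
  define g where "g i c = (if i = k then F c else 1)" for i c
  have "(\<Sum>f\<in>I \<rightarrow>\<^sub>E C. F (f k)) = (\<Sum>f\<in>I \<rightarrow>\<^sub>E C. \<Prod>i\<in>I. g i (f i))"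
    using assms by (simp add: g_def prod.delta)
  also have "\<dots> = (\<Prod>i\<in>I. \<Sum>c\<in>C. g i c)"
    using assms by (intro prod_sum_PiE[symmetric]) auto
  also have "\<dots> = (\<Sum>c\<in>C. g k c) * (\<Prod>i\<in>I - {k}. \<Sum>c\<in>C. g i c)"
    using assms by (intro prod.remove) auto
  also have "(\<Prod>i\<in>I - {k}. \<Sum>c\<in>C. g i c) = (\<Prod>i\<in>I - {k}. real (card C))"
    by (intro prod.cong) (auto simp: g_def)
  finally show ?thesis using assms by (simp add: g_def)
qed

text \<open>\<open>sqrt (v / 2)\<close> is the standard deviation of each coordinate, and
  independence makes the joint law of the scaled coordinates the product measure behind
  \<open>cgauss\<close>.\<close>

lemma complex_normal_standardise:
  assumes P: "prob_space P" and X: "complex_normal P X v" and v: "v > 0"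
  shows "(\<lambda>\<omega>. X \<omega> / of_real (sqrt (v / 2))) \<in> borel_measurable P"
    and "distr P borel (\<lambda>\<omega>. X \<omega> / of_real (sqrt (v / 2))) = cgauss"
proof -
  interpret prob_space P by fact
  define \<tau> where "\<tau> = sqrt (v / 2)"
  have \<tau>: "\<tau> > 0" using v by (simp add: \<tau>_def)
  define U where "U \<omega> = Re (X \<omega>) / \<tau>" for \<omega>
  define W where "W \<omega> = Im (X \<omega>) / \<tau>" for \<omega>
  have ind: "indep_var borel (\<lambda>\<omega>. Re (X \<omega>)) borel (\<lambda>\<omega>. Im (X \<omega>))"
    and dR: "distributed P lborel (\<lambda>\<omega>. Re (X \<omega>)) (\<lambda>t. ennreal (normal_density 0 \<tau> t))"
    and dI: "distributed P lborel (\<lambda>\<omega>. Im (X \<omega>)) (\<lambda>t. ennreal (normal_density 0 \<tau> t))"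
    using X by (auto simp: complex_normal_def \<tau>_def)
  have std: "distr P borel (\<lambda>\<omega>. Y \<omega> / \<tau>) = gauss"
    if "distributed P lborel Y (\<lambda>t. ennreal (normal_density 0 \<tau> t))" for Y
  proof -
    have "distributed P lborel (\<lambda>\<omega>. Y \<omega> / \<tau>) (\<lambda>t. ennreal (std_normal_density t))"
      using normal_standard_normal_convert[OF \<tau>, of Y 0] that by simp
    from distributed_distr_eq_density[OF this]
    have "distr P lborel (\<lambda>\<omega>. Y \<omega> / \<tau>) = gauss" by (simp add: gauss_def)
    moreover have "distr P lborel (\<lambda>\<omega>. Y \<omega> / \<tau>) = distr P borel (\<lambda>\<omega>. Y \<omega> / \<tau>)"
      by (rule distr_cong) auto
    ultimately show ?thesis by simp
  qed
  have "indep_var borel ((\<lambda>x. x / \<tau>) \<circ> (\<lambda>\<omega>. Re (X \<omega>))) borel ((\<lambda>x. x / \<tau>) \<circ> (\<lambda>\<omega>. Im (X \<omega>)))"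
    by (rule indep_var_compose[OF ind]) auto
  then have "indep_var borel U borel W" by (simp add: comp_def U_def[abs_def] W_def[abs_def])
  then have [measurable]: "U \<in> borel_measurable P" "W \<in> borel_measurable P"
    and joint: "distr P borel U \<Otimes>\<^sub>M distr P borel W = distr P (borel \<Otimes>\<^sub>M borel) (\<lambda>\<omega>. (U \<omega>, W \<omega>))"
    unfolding indep_var_distribution_eq by auto
  have eq: "(\<lambda>\<omega>. X \<omega> / of_real (sqrt (v / 2))) = (\<lambda>\<omega>. (\<lambda>(x, y). Complex x y) (U \<omega>, W \<omega>))"
    by (auto simp: U_def W_def \<tau>_def complex_eq_iff)
  show "(\<lambda>\<omega>. X \<omega> / of_real (sqrt (v / 2))) \<in> borel_measurable P"
    unfolding eq by (rule measurable_compose[OF _ measurable_Complex]) measurable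
  have "gauss \<Otimes>\<^sub>M gauss = distr P (borel \<Otimes>\<^sub>M borel) (\<lambda>\<omega>. (U \<omega>, W \<omega>))"
    using joint std[OF dR] std[OF dI] by (simp add: U_def[abs_def] W_def[abs_def])
  then show "distr P borel (\<lambda>\<omega>. X \<omega> / of_real (sqrt (v / 2))) = cgauss"
    unfolding cgauss_def eq by (simp add: distr_distr comp_def)
qed

text \<open>Grouping the vectors by their \<open>k\<close>-th entry turns the sums over
  \<open>m\<close> and \<open>i\<close> into sums over the constellation. The multiplicity adds the
  same \<open>ln L\<close> on both sides.\<close>

lemma rate_zf_av_le_bound:
  assumes P: "prob_space P" and M: "M \<ge> 1" and k: "k \<in> {1..N}"
    and v: "\<sigma>\<^sup>2 > 0" and n: "complex_normal P n (\<sigma>\<^sup>2)"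
    and s: "bij_betw s {1..M^N} (psk_vectors M N)"
    and j: "\<And>m. m \<in> {1..M^N} \<Longrightarrow> j m \<in> {1..M^N}"
  shows "rate_zf_av P N M b s n \<sigma> k \<le> rate_zf_bound N M b s j \<sigma> k"
proof -
  interpret prob_space P by fact
  interpret reflective_constellation "psk M" by (rule reflective_constellation_psk[OF M])
  \<comment> \<open>The unit of length is the noise deviation per coordinate. As
    \<open>\<sigma>\<^sup>2 = 2 * \<tau>\<^sup>2\<close>, the denominators
    \<open>\<sigma>\<^sup>2\<close> and \<open>2 * \<sigma>\<^sup>2\<close> become 2 and 4.\<close>
  define \<tau> where "\<tau> = sqrt (\<sigma>\<^sup>2 / 2)"
  define B where "B = b / \<tau>"
  \<comment> \<open>The number of vectors with a prescribed \<open>k\<close>-th entry.\<close>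
  define L where "L = real (card (psk M) ^ (N - 1))"
  define \<zeta> where "\<zeta> \<omega> = n \<omega> / of_real \<tau>" for \<omega>
  have \<tau>: "\<tau> > 0" "\<tau>\<^sup>2 = \<sigma>\<^sup>2 / 2" using v by (simp_all add: \<tau>_def)
  have L: "L > 0" using fin nonempty by (simp add: L_def card_gt_0_iff)
  have \<zeta>: "\<zeta> \<in> borel_measurable P" "distr P borel \<zeta> = cgauss"
    using complex_normal_standardise[OF P n v] by (simp_all add: \<zeta>_def[abs_def] \<tau>_def)
  have sum_s: "(\<Sum>i=1..M^N. F (s i k)) = L * (\<Sum>c\<in>psk M. F c)" for F :: "complex \<Rightarrow> real"
    using sum.reindex_bij_betw[OF s, of "\<lambda>f. F (f k)"] sum_PiE_coordinate[of "{1..N}" k "psk M" F] k fin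
    by (simp add: psk_vectors_def L_def)
  have sC: "s m k \<in> psk M" if "m \<in> {1..M^N}" for m
    using bij_betw_apply[OF s that] k unfolding psk_vectors_def by (rule PiE_mem)
  define E1 where "E1 c z = ln (\<Sum>i\<in>psk M. exp (- (cmod (of_real B * (c - i) + z))\<^sup>2 / 2))" for c z
  define E0 where "E0 c = ln (\<Sum>i\<in>psk M. exp (- (cmod (of_real B * (c - i)))\<^sup>2 / 4))" for c
  have sp: "(\<Sum>i\<in>psk M. exp (g i :: real)) > 0" for g
    by (rule sum_pos) (use fin nonempty in auto)
  have sp0: "(\<Sum>i\<in>psk M. exp (g i :: real)) \<noteq> 0" for g
    using sp[of g] by simp
  have scale: "(cmod (of_real b * d + w))\<^sup>2 = (cmod (of_real B * d + w / of_real \<tau>))\<^sup>2 * (\<sigma>\<^sup>2 / 2)" for d w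
  proof -
    have "of_real b * d + w = of_real \<tau> * (of_real B * d + w / of_real \<tau>)"
      using \<tau>(1) by (simp add: B_def field_simps)
    then have "cmod (of_real b * d + w) = \<tau> * cmod (of_real B * d + w / of_real \<tau>)"
      using \<tau>(1) by (simp add: norm_mult)
    then show ?thesis using \<tau>(2) by (simp add: power_mult_distrib)
  qed
  have av: "expectation (\<lambda>\<omega>. log 2 (\<Sum>i=1..M^N. exp (- (cmod (of_real b * (s m k - s i k) + n \<omega>))\<^sup>2 / \<sigma>\<^sup>2)))
      = (ln L + (\<integral>z. E1 (s m k) z \<partial>cgauss)) / ln 2" if m: "m \<in> {1..M^N}" for m
  proof -
    have "log 2 (\<Sum>i=1..M^N. exp (- (cmod (of_real b * (s m k - s i k) + n \<omega>))\<^sup>2 / \<sigma>\<^sup>2)) =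
        (ln L + E1 (s m k) (\<zeta> \<omega>)) / ln 2" for \<omega>
    proof -
      have "(\<Sum>i=1..M^N. exp (- (cmod (of_real b * (s m k - s i k) + n \<omega>))\<^sup>2 / \<sigma>\<^sup>2)) =
          (\<Sum>i=1..M^N. exp (- (cmod (of_real B * (s m k - s i k) + \<zeta> \<omega>))\<^sup>2 / 2))"
        using v by (simp add: scale \<zeta>_def)
      also have "\<dots> = L * (\<Sum>c\<in>psk M. exp (- (cmod (of_real B * (s m k - c) + \<zeta> \<omega>))\<^sup>2 / 2))"
        by (rule sum_s[of "\<lambda>c. exp (- (cmod (of_real B * (s m k - c) + \<zeta> \<omega>))\<^sup>2 / 2)"])
      finally show ?thesis using L by (simp add: log_def ln_mult E1_def sp sp0)
    qed
    moreover have int: "integrable (distr P borel \<zeta>) (E1 (s m k))"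
      unfolding \<zeta>(2) E1_def by (rule integrable_ln_sum_exp_dist[OF sC[OF m]])
    have [measurable]: "E1 (s m k) \<in> borel_measurable borel"
      unfolding E1_def by measurable
    have "integrable P (\<lambda>\<omega>. E1 (s m k) (\<zeta> \<omega>))"
      "expectation (\<lambda>\<omega>. E1 (s m k) (\<zeta> \<omega>)) = (\<integral>z. E1 (s m k) z \<partial>cgauss)"
      using integrable_distr[OF \<zeta>(1) int] by (simp_all add: \<zeta>(2)[symmetric] integral_distr \<zeta>(1))
    ultimately show ?thesis using prob_space by simp
  qed
  have bd: "- ((cmod (of_real b * (s m k - s (j m) k)))\<^sup>2 + \<sigma>\<^sup>2) * (log 2 (exp 1) / \<sigma>\<^sup>2)
      + log 2 (1 + (\<Sum>i\<in>{1..M^N} - {j m}. exp (- ((cmod (of_real b * (s m k - s i k)))\<^sup>2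
          - (cmod (of_real b * (s m k - s (j m) k)))\<^sup>2) / (2 * \<sigma>\<^sup>2))))
      \<le> (ln L + (E0 (s m k) - 1)) / ln 2" if m: "m \<in> {1..M^N}" for m
  proof -
    define A where "A i = (cmod (of_real b * (s m k - s i k)))\<^sup>2" for i
    define q where "q = A (j m)"
    \<comment> \<open>The leading 1 is the missing term \<open>i = j m\<close>, whose exponent is
      0.\<close>
    have "1 + (\<Sum>i\<in>{1..M^N} - {j m}. exp (- (A i - q) / (2 * \<sigma>\<^sup>2))) =
        (\<Sum>i=1..M^N. exp (- (A i - q) / (2 * \<sigma>\<^sup>2)))"
      using j[OF m] by (simp add: sum.remove[of _ "j m"] q_def)
    also have "\<dots> = exp (q / (2 * \<sigma>\<^sup>2)) * (\<Sum>i=1..M^N. exp (- A i / (2 * \<sigma>\<^sup>2)))"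
      unfolding sum_distrib_left exp_add[symmetric]
      by (simp add: diff_divide_distrib)
    also have "(\<Sum>i=1..M^N. exp (- A i / (2 * \<sigma>\<^sup>2))) =
        (\<Sum>i=1..M^N. exp (- (cmod (of_real B * (s m k - s i k)))\<^sup>2 / 4))"
    proof (rule sum.cong[OF refl])
      fix i
      have "A i = (cmod (of_real B * (s m k - s i k)))\<^sup>2 * (\<sigma>\<^sup>2 / 2)"
        using scale[of "s m k - s i k" 0] by (simp add: A_def)
      then show "exp (- A i / (2 * \<sigma>\<^sup>2)) = exp (- (cmod (of_real B * (s m k - s i k)))\<^sup>2 / 4)"
        using v by (simp add: field_simps)
    qed
    also have "\<dots> = L * (\<Sum>c\<in>psk M. exp (- (cmod (of_real B * (s m k - c)))\<^sup>2 / 4))"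
      by (rule sum_s[of "\<lambda>c. exp (- (cmod (of_real B * (s m k - c)))\<^sup>2 / 4)"])
    finally have eq: "log 2 (1 + (\<Sum>i\<in>{1..M^N} - {j m}. exp (- (A i - q) / (2 * \<sigma>\<^sup>2)))) =
        (q / (2 * \<sigma>\<^sup>2) + ln L + E0 (s m k)) / ln 2"
      using L by (simp add: log_def ln_mult E0_def sp sp0)
    \<comment> \<open>The factor \<open>exp (q / (2 * \<sigma>\<^sup>2))\<close> recovers only half
      of the penalty \<open>q / \<sigma>\<^sup>2\<close>, so the expression is largest for
      \<open>q = 0\<close>, as with \<open>j m = m\<close>.\<close>
    have "- (q + \<sigma>\<^sup>2) * (log 2 (exp 1) / \<sigma>\<^sup>2) + (q / (2 * \<sigma>\<^sup>2) + ln L + E0 (s m k)) / ln 2 =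
        (ln L + (E0 (s m k) - 1)) / ln 2 - q / (2 * \<sigma>\<^sup>2 * ln 2)"
      using v by (simp add: log_def field_simps)
    moreover have "q / (2 * \<sigma>\<^sup>2 * ln 2) \<ge> 0" by (simp add: q_def A_def)
    ultimately show ?thesis using eq unfolding A_def q_def by linarith
  qed
  \<comment> \<open>\<open>sum_s\<close> carries the sum over vectors to the constellation, where
    the path inequality applies, and back again.\<close>
  have "(\<Sum>m=1..M^N. (ln L + (E0 (s m k) - 1)) / ln 2) =
      L * (\<Sum>c\<in>psk M. (ln L + (E0 c - 1)) / ln 2)"
    by (rule sum_s)
  also have "\<dots> \<le> L * (\<Sum>c\<in>psk M. (ln L + (\<integral>z. E1 c z \<partial>cgauss)) / ln 2)"
    using sum_integral_ln_sum_exp_dist_ge[of B] L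
    by (simp add: E0_def E1_def sum_divide_distrib[symmetric] sum.distrib divide_right_mono)
  also have "\<dots> = (\<Sum>m=1..M^N. (ln L + (\<integral>z. E1 (s m k) z \<partial>cgauss)) / ln 2)"
    by (rule sum_s[symmetric])
  finally have main: "(\<Sum>m=1..M^N. (ln L + (E0 (s m k) - 1)) / ln 2) \<le>
      (\<Sum>m=1..M^N. (ln L + (\<integral>z. E1 (s m k) z \<partial>cgauss)) / ln 2)" .
  have "(\<Sum>m=1..M^N. expectation (\<lambda>\<omega>. log 2 (\<Sum>i=1..M^N.
        exp (- (cmod (of_real b * (s m k - s i k) + n \<omega>))\<^sup>2 / \<sigma>\<^sup>2)))) =
      (\<Sum>m=1..M^N. (ln L + (\<integral>z. E1 (s m k) z \<partial>cgauss)) / ln 2)"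
    by (rule sum.cong[OF refl]) (rule av)
  note rates_le = main[folded this]
  show ?thesis
    unfolding rate_zf_av_def rate_zf_bound_def
    by (rule diff_left_mono, rule mult_left_mono, rule order_trans[OF sum_mono rates_le], erule bd) simp
qed

theorem theorem2:
  fixes P :: "'a measure"
    and N K M :: nat
    and p \<alpha> \<beta> :: real
    and d \<sigma> :: "nat \<Rightarrow> real"
    and n :: "nat \<Rightarrow> 'a \<Rightarrow> complex"
    and x :: "nat \<Rightarrow> complex"
    and s :: "nat \<Rightarrow> nat \<Rightarrow> complex"
    and j :: "nat \<Rightarrow> nat"
  assumes "prob_space P"
    and "1 \<le> K" and "K \<le> N" and "2 \<le> M"
    and "p > 0" and "\<alpha> > 0"
    and "\<And>k. k \<in> {1..K} \<Longrightarrow> d k > 0"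
    and "\<And>k. k \<in> {1..K} \<Longrightarrow> (\<sigma> k)\<^sup>2 > 0"
    and "\<And>k. k \<in> {1..K} \<Longrightarrow> complex_normal P (n k) ((\<sigma> k)\<^sup>2)"
    and "x \<in> psk_vectors M K"
    and "\<beta> = zf_scaling N K p \<alpha> d x"
    and "bij_betw s {1..M^N} (psk_vectors M N)"
    and "\<And>m. m \<in> {1..M^N} \<Longrightarrow> j m \<in> {1..M^N}"
  shows "(\<Sum>k=1..K. rate_zf_av P N M \<beta> s (n k) (\<sigma> k) k)
       \<le> (\<Sum>k=1..K. rate_zf_bound N M \<beta> s j (\<sigma> k) k)"
proof (rule sum_mono)
  fix k assume k: "k \<in> {1..K}"
  \<comment> \<open>The users are treated separately; \<open>k \<le> K \<le> N\<close> makes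
    \<open>k\<close> a valid position in vectors of length \<open>N\<close>.\<close>
  show "rate_zf_av P N M \<beta> s (n k) (\<sigma> k) k \<le> rate_zf_bound N M \<beta> s j (\<sigma> k) k"
    by (rule rate_zf_av_le_bound) (use assms k in auto)
qed

end
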